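(* Let $\Omega\subset\mathbb{R}^n$ be open and let $p:\Omega\to[1,\infty)$ be measurable with $p^+=\operatorname{ess\,sup}_{\Omega}p<\infty$. Let $E_1\subset E_2\subset\dots\subset E_i\subset E_{i+1}\subset\dots\subset\Omega$ be an increasing sequence of sets. Then $$C_{\widetilde{\mathrm{BV}}^{p(\cdot)}}\Big(\bigcup_{i=1}^\infty E_i\Big)=\lim_{i\to\infty}C_{\widetilde{\mathrm{BV}}^{p(\cdot)}}(E_i).$$
   Context: $L^{p(\cdot)}(\Omega)$ is the variable exponent Lebesgue space of measurable $u:\Omega\to\mathbb{R}$ (identified when equal a.e.) with $\int_\Omega |u/\lambda|^{p(x)}dx<\infty$ for some $\lambda>0$, with Luxemburg norm $\|u\|_{p(\cdot)}=\inf\{\lambda>0:\int_\Omega|u/\lambda|^{p(x)}dx\le 1\}$; $\varrho_{p(\cdot)}(u)=\int_\Omega|u(x)|^{p(x)}dx$. $\mathrm{Lip}_{\mathrm{loc}}(\Omega)$ denotes the locally Lipschitz functions on $\Omega$. For $u\in L^{p(\cdot)}(\Omega)$ define $$\varrho_{\widetilde{\mathrm{BV}}^{p(\cdot)}}(u)=\inf\Big\{\liminf_{i\to\infty}\int_\Omega|\nabla u_i(x)|^{p(x)}dx\Big\},$$ the infimum being over all sequences $(u_i)$ in $\mathrm{Lip}_{\mathrm{loc}}(\Omega)\cap L^{p(\cdot)}(\Omega)$ with $u_i\to u$ in $L^{p(\cdot)}(\Omega)$, and $\widetilde{\mathrm{BV}}^{p(\cdot)}(\Omega)=\{u\in L^{p(\cdot)}(\Omega):\varrho_{\widetilde{\mathrm{BV}}^{p(\cdot)}}(u)<\infty\}$.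 For $E\subset\Omega$ let $\mathcal{A}_{\widetilde{\mathrm{BV}}^{p(\cdot)}}(E)$ be the set of $u\in\widetilde{\mathrm{BV}}^{p(\cdot)}(\Omega)$ with $0\le u\le1$ and $u=1$ in an open neighbourhood of $E$. The mixed capacity of $E\subset\Omega$ is $$C_{\widetilde{\mathrm{BV}}^{p(\cdot)}}(E)=\inf\{\varrho_{p(\cdot)}(u)+\varrho_{\widetilde{\mathrm{BV}}^{p(\cdot)}}(u):u\in\mathcal{A}_{\widetilde{\mathrm{BV}}^{p(\cdot)}}(E)\},$$ with $\inf\varnothing=\infty$. *)

theory Defs
  imports "HOL-Analysis.Analysis" "HOL-Probability.Essential_Supremum"
begin

text \<open>
  Functions on an open set \<open>\<Omega>\<close> are total functions whose values outside \<open>\<Omega>\<close> are never used.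
  Elements of \<open>L\<^sup>p\<^sup>(\<^sup>\<cdot>\<^sup>)(\<Omega>)\<close> are represented by functions rather than by classes modulo
  almost everywhere equality; accordingly, pointwise conditions on such elements are imposed
  almost everywhere.  Modulars and capacities are valued in \<^typ>\<open>ennreal\<close>, where
  \<open>Inf {} = \<infinity>\<close>.
\<close>

definition modular :: "(real^'n) set \<Rightarrow> (real^'n \<Rightarrow> real) \<Rightarrow> (real^'n \<Rightarrow> real) \<Rightarrow> ennreal" where
  "modular \<Omega> p u = (\<integral>\<^sup>+ x. ennreal (\<bar>u x\<bar> powr p x) \<partial>lebesgue_on \<Omega>)"

definition Lp_var :: "(real^'n) set \<Rightarrow> (real^'n \<Rightarrow> real) \<Rightarrow> (real^'n \<Rightarrow> real) set" where
  "Lp_var \<Omega> p = {u \<in> borel_measurable (lebesgue_on \<Omega>).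
                    \<exists>l>0. modular \<Omega> p (\<lambda>x. u x / l) < \<infinity>}"

definition luxemburg_norm :: "(real^'n) set \<Rightarrow> (real^'n \<Rightarrow> real) \<Rightarrow> (real^'n \<Rightarrow> real) \<Rightarrow> real" where
  "luxemburg_norm \<Omega> p u = Inf {l. l > 0 \<and> modular \<Omega> p (\<lambda>x. u x / l) \<le> 1}"

definition Lip_loc :: "(real^'n) set \<Rightarrow> (real^'n \<Rightarrow> real) set" where
  "Lip_loc \<Omega> = {u. \<forall>x\<in>\<Omega>. \<exists>r>0. \<exists>L. L-lipschitz_on (ball x r \<inter> \<Omega>) u}"

text \<open>
  By Rademacher's theorem a locally Lipschitz function is differentiable almost everywhere in
  \<open>\<Omega>\<close>, so the default value only matters on a null set.
\<close>

definition grad :: "(real^'n \<Rightarrow> real) \<Rightarrow> real^'n \<Rightarrow> real^'n" where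
  "grad u x = (if u differentiable (at x) then (THE D. GDERIV u x :> D) else 0)"

definition BV_modular :: "(real^'n) set \<Rightarrow> (real^'n \<Rightarrow> real) \<Rightarrow> (real^'n \<Rightarrow> real) \<Rightarrow> ennreal" where
  "BV_modular \<Omega> p u =
     Inf {liminf (\<lambda>i. \<integral>\<^sup>+ x. ennreal (norm (grad (v i) x) powr p x) \<partial>lebesgue_on \<Omega>) | v.
            (\<forall>i. v i \<in> Lip_loc \<Omega> \<inter> Lp_var \<Omega> p) \<and>
            (\<lambda>i. luxemburg_norm \<Omega> p (\<lambda>x. v i x - u x)) \<longlonglongrightarrow> 0}"

definition BV_var :: "(real^'n) set \<Rightarrow> (real^'n \<Rightarrow> real) \<Rightarrow> (real^'n \<Rightarrow> real) set" where
  "BV_var \<Omega> p = {u \<in> Lp_var \<Omega> p. BV_modular \<Omega> p u < \<infinity>}"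

definition admissible ::
    "(real^'n) set \<Rightarrow> (real^'n \<Rightarrow> real) \<Rightarrow> (real^'n) set \<Rightarrow> (real^'n \<Rightarrow> real) set" where
  "admissible \<Omega> p E = {u \<in> BV_var \<Omega> p.
     (AE x in lebesgue_on \<Omega>. 0 \<le> u x \<and> u x \<le> 1) \<and>
     (\<exists>U. open U \<and> E \<subseteq> U \<and> U \<subseteq> \<Omega> \<and> (AE x in lebesgue_on U. u x = 1))}"

definition mixed_capacity ::
    "(real^'n) set \<Rightarrow> (real^'n \<Rightarrow> real) \<Rightarrow> (real^'n) set \<Rightarrow> ennreal" where
  "mixed_capacity \<Omega> p E = Inf {modular \<Omega> p u + BV_modular \<Omega> p u | u. u \<in> admissible \<Omega> p E}"

end

theory Submission
  imports Defs
begin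

text \<open>
  The capacity functional \<open>\<rho> u = modular \<Omega> p u + BV_modular \<Omega> p u\<close> is strongly subadditive,
  \<open>\<rho> (max u v) + \<rho> (min u v) \<le> \<rho> u + \<rho> v\<close>, because for locally Lipschitz \<open>u\<close> and \<open>v\<close> the
  gradients of \<open>max u v\<close> and \<open>min u v\<close> are almost everywhere those of \<open>u\<close> and \<open>v\<close> in some order.
  On the coincidence set \<open>{u = v}\<close> this does not need Rademacher's theorem: the zero set of the
  Lipschitz function \<open>u - v\<close> is not porous at almost all of its points, so \<open>u - v\<close> has derivative
  \<open>0\<close> there.

  Now choose \<open>u\<^sub>i\<close> admissible for \<open>E\<^sub>i\<close> with \<open>\<rho> u\<^sub>i \<le> C E\<^sub>i + 2\<^sup>-\<^sup>i\<^sup>-\<^sup>1 e\<close> and put \<open>v\<^sub>i = max u\<^sub>0 \<dots> u\<^sub>i\<close>.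
  Since \<open>min v\<^sub>i u\<^sub>i\<^sub>+\<^sub>1\<close> is admissible for \<open>E\<^sub>i\<close>, strong subadditivity gives inductively
  \<open>\<rho> v\<^sub>i \<le> C E\<^sub>i + e\<close>. The increasing limit of the \<open>v\<^sub>i\<close> is admissible for the union, and \<open>\<rho>\<close> is
  lower semicontinuous along the sequence.
\<close>

section \<open>Zero sets of locally Lipschitz functions\<close>

text \<open>A Vitali cover of \<open>B\<close> by small balls, each with a hole missing
  \<open>B\<close>, shows that removing the holes lowers the measure of any open superset by a fixed
  factor. The outer measure of \<open>B\<close> is then at most \<theta> < 1 times itself, hence
  zero.\<close>

lemma porous_negligible:
  fixes B :: "'a::euclidean_space set"
  assumes c: "0 < c" "c \<le> 1"
    and hole: "\<And>x d. x \<in> B \<Longrightarrow> 0 < d \<Longrightarrow>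
      \<exists>r y. 0 < r \<and> r < d \<and> ball y (c * r) \<subseteq> ball x r \<and> ball y (c * r) \<inter> B = {}"
  shows "negligible B"
proof -
  \<comment> \<open>For bounded sets, measurable supersets of finite measure exist, so the infimum
    \<open>m\<close> below is taken over a nonempty set.\<close>
  have bdd: "negligible B" if bnd: "bounded B" and hole: "\<And>x d. x \<in> B \<Longrightarrow> 0 < d \<Longrightarrow>
      \<exists>r y. 0 < r \<and> r < d \<and> ball y (c * r) \<subseteq> ball x r \<and> ball y (c * r) \<inter> B = {}" for B :: "'a set"
  proof -
    \<comment> \<open>The proportion of a ball of radius \<open>r\<close> that remains after a
      concentric-or-not ball of radius \<open>c * r\<close> inside it is removed.\<close>
    define \<theta> where "\<theta> = 1 - c ^ DIM('a)"
    have \<theta>: "0 \<le> \<theta>" "\<theta> < 1"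
      using c by (auto simp: \<theta>_def power_le_one)
    \<comment> \<open>Discarding the holes from a Vitali cover of \<open>B\<close> inside \<open>T\<close> costs a fixed proportion of the measure.\<close>
    have shrink: "\<exists>T'. B \<subseteq> T' \<and> T' \<in> lmeasurable \<and> measure lebesgue T' \<le> \<theta> * measure lebesgue T"
      if T: "open T" "T \<in> lmeasurable" "B \<subseteq> T" for T
    proof -
      \<comment> \<open>The covering theorem works with indexed balls, so an index carries the hole
        along: centre \<open>x\<close>, radius \<open>r\<close>, hole centre
        \<open>y\<close>.\<close>
      define K where "K = {(x, r, y). x \<in> B \<and> 0 < r \<and> ball x r \<subseteq> T \<and>
          ball y (c * r) \<subseteq> ball x r \<and> ball y (c * r) \<inter> B = {}}"
      have "\<exists>i. i \<in> K \<and> x \<in> ball (fst i) (fst (snd i)) \<and> fst (snd i) < d" if "x \<in> B" "0 < d" for x d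
      proof -
        obtain k where k: "k > 0" "ball x k \<subseteq> T"
          by (rule openE[OF T(1) subsetD[OF T(3) \<open>x \<in> B\<close>]])
        obtain r y where "0 < r" "r < min d k" "ball y (c * r) \<subseteq> ball x r" "ball y (c * r) \<inter> B = {}"
          using hole[OF \<open>x \<in> B\<close>, of "min d k"] \<open>0 < d\<close> \<open>k > 0\<close> by auto
        moreover from this have "ball x r \<subseteq> T"
          using k(2) by (force simp: subset_iff)
        ultimately show ?thesis
          using that by (intro exI[of _ "(x, r, y)"]) (auto simp: K_def)
      qed
      then obtain C where C: "countable C" "C \<subseteq> K"
         "pairwise (\<lambda>i j. disjnt (ball (fst i) (fst (snd i))) (ball (fst j) (fst (snd j)))) C"
         "negligible (B - (\<Union>i \<in> C. ball (fst i) (fst (snd i))))"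
        by (rule Vitali_covering_theorem_balls[of B K fst "\<lambda>i. fst (snd i)"])
      define b where "b i = ball (fst i) (fst (snd i))" for i :: "'a \<times> real \<times> 'a"
      define h where "h i = ball (snd (snd i)) (c * fst (snd i))" for i :: "'a \<times> real \<times> 'a"
      define N where "N = B - (\<Union>i \<in> C. b i)"
      define T' where "T' = (\<Union>i\<in>C. b i - h i)"
      have KD: "fst i \<in> B" "0 < fst (snd i)" "b i \<subseteq> T" "h i \<subseteq> b i" "h i \<inter> B = {}" if "i \<in> C" for i
        using subsetD[OF C(2) that] by (simp_all add: K_def b_def h_def case_prod_beta)
      have disj: "disjoint_family_on b C"
        using C(3) by (auto simp: disjoint_family_on_def pairwise_def disjnt_def b_def)
      then have disj': "disjoint_family_on (\<lambda>i. b i - h i) C"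
        unfolding disjoint_family_on_def by blast
      have [measurable]: "b i \<in> sets lebesgue" "h i \<in> sets lebesgue" for i
        by (auto simp: b_def h_def)
      have meas_le: "emeasure lebesgue (b i - h i) = ennreal \<theta> * emeasure lebesgue (b i)" if "i \<in> C" for i
      proof -
        have bm: "b i \<in> lmeasurable" "h i \<in> lmeasurable"
          by (auto simp: b_def h_def)
        have hb: "measure lebesgue (h i) = c ^ DIM('a) * measure lebesgue (b i)"
          using KD(2)[OF that] c
          by (simp add: b_def h_def content_ball_conv_unit_ball[of "c * fst (snd i)"]
              content_ball_conv_unit_ball[of "fst (snd i)"] power_mult_distrib)
        have "measure lebesgue (b i - h i) = measure lebesgue (b i) - measure lebesgue (h i)"
          using bm KD(4)[OF that] by (intro measurable_measure_Diff) (auto dest: fmeasurableD)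
        also have "\<dots> = \<theta> * measure lebesgue (b i)"
          by (simp add: hb \<theta>_def algebra_simps)
        finally have "ennreal (measure lebesgue (b i - h i)) = ennreal \<theta> * ennreal (measure lebesgue (b i))"
          using \<theta> by (simp add: ennreal_mult)
        then show ?thesis
          using bm by (simp add: emeasure_eq_measure2 fmeasurable.Diff)
      qed
      have "emeasure lebesgue T' = (\<integral>\<^sup>+i. emeasure lebesgue (b i - h i) \<partial>count_space C)"
        unfolding T'_def using C(1) disj' by (intro emeasure_UN_countable) auto
      also have "\<dots> = (\<integral>\<^sup>+i. ennreal \<theta> * emeasure lebesgue (b i) \<partial>count_space C)"
        using meas_le by (intro nn_integral_cong) (simp only: space_count_space)
      also have "\<dots> = ennreal \<theta> * (\<integral>\<^sup>+i. emeasure lebesgue (b i) \<partial>count_space C)"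
        by (intro nn_integral_cmult) auto
      also have "(\<integral>\<^sup>+i. emeasure lebesgue (b i) \<partial>count_space C) = emeasure lebesgue (\<Union>i\<in>C. b i)"
        using C(1) disj by (intro emeasure_UN_countable[symmetric]) auto
      also have "\<dots> \<le> emeasure lebesgue T"
        using KD(3) T(2) by (intro emeasure_mono) (auto dest: fmeasurableD)
      finally have le: "emeasure lebesgue T' \<le> ennreal \<theta> * emeasure lebesgue T"
        by (simp add: mult_left_mono)
      have T'sets: "T' \<in> sets lebesgue"
        unfolding T'_def using C(1) by auto
      have T'sub: "T' \<subseteq> T"
        using KD(3) by (auto simp: T'_def)
      have T'm: "T' \<in> lmeasurable"
        using T'sets T'sub T(2) fmeasurableI2 by blast
      have N: "negligible N"
        using C(4) by (simp add: N_def b_def)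
      have "measure lebesgue (T' \<union> N) = measure lebesgue T'"
        using N by (intro measure_Un_null_set) (auto simp: T'sets negligible_iff_null_sets)
      moreover have "measure lebesgue T' \<le> \<theta> * measure lebesgue T"
        using le T'm T(2) \<theta> by (simp add: emeasure_eq_measure2 flip: ennreal_mult)
      moreover have "B \<subseteq> T' \<union> N"
        using KD(5) unfolding T'_def N_def by blast
      moreover have "T' \<union> N \<in> lmeasurable"
        using T'm N negligible_imp_measurable by blast
      ultimately show ?thesis by metis
    qed
    \<comment> \<open>The outer Lebesgue measure of \<open>B\<close>.\<close>
    define m where "m = Inf (measure lebesgue ` {T. B \<subseteq> T \<and> T \<in> lmeasurable})"
    have ne: "{T. B \<subseteq> T \<and> T \<in> lmeasurable} \<noteq> {}"
    proof -
      obtain a r where "B \<subseteq> cball a r"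
        using bnd by (meson bounded_subset_cball)
      then have "cball a r \<in> {T. B \<subseteq> T \<and> T \<in> lmeasurable}" by simp
      then show ?thesis by (rule ex_in_conv[THEN iffD1, OF exI])
    qed
    have bb: "bdd_below (measure lebesgue ` {T. B \<subseteq> T \<and> T \<in> lmeasurable})"
      by (rule bdd_belowI2[of _ 0]) simp
    \<comment> \<open>\<open>shrink\<close> applies to open sets only; enlarging \<open>T\<close> to
      an open set costs the extra \<open>e\<close>.\<close>
    have m_step: "m \<le> \<theta> * (measure lebesgue T + e)" if T: "B \<subseteq> T" "T \<in> lmeasurable" "0 < e" for T e
    proof -
      obtain U where U: "open U" "T \<subseteq> U" "U \<in> lmeasurable" "measure lebesgue U < measure lebesgue T + e"
      proof -
        obtain U where U: "open U" "T \<subseteq> U" "U - T \<in> lmeasurable" "emeasure lebesgue (U - T) < ennreal e"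
          by (rule sets_lebesgue_outer_open[OF fmeasurableD[OF T(2)] T(3)])
        have "U = T \<union> (U - T)" using U(2) by blast
        then have Um: "U \<in> lmeasurable" using fmeasurable.Un[OF T(2) U(3)] by simp
        have "measure lebesgue (U - T) = measure lebesgue U - measure lebesgue T"
          using Um U(2) fmeasurableD[OF T(2)] by (intro measurable_measure_Diff)
        moreover have "measure lebesgue (U - T) < e"
          using U(3,4) T(3) by (simp add: emeasure_eq_measure2 ennreal_less_iff)
        ultimately show thesis using U(1,2) Um by (intro that) auto
      qed
      obtain T' where T': "B \<subseteq> T'" "T' \<in> lmeasurable" "measure lebesgue T' \<le> \<theta> * measure lebesgue U"
        using shrink[OF U(1,3)] U(2) T(1) by (meson order_trans)
      have "m \<le> measure lebesgue T'"
        unfolding m_def using T' by (intro cINF_lower bb) auto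
      also have "\<dots> \<le> \<theta> * (measure lebesgue T + e)"
        using T'(3) U(4) \<theta>(1) by (smt (verit) mult_left_mono)
      finally show ?thesis .
    qed
    have near: "\<exists>T. B \<subseteq> T \<and> T \<in> lmeasurable \<and> measure lebesgue T < a" if "m < a" for a
      using cInf_lessD[OF _ that[unfolded m_def]] ne by blast
    have m_le: "m \<le> \<theta> * m + 2 * e" if e: "0 < e" for e
    proof -
      obtain T where T: "B \<subseteq> T" "T \<in> lmeasurable" "measure lebesgue T < m + e"
        using near[of "m + e"] e by auto
      have "m \<le> \<theta> * (measure lebesgue T + e)"
        using m_step[OF T(1,2) e] .
      also have "\<dots> \<le> \<theta> * (m + 2 * e)"
        using T \<theta> by (intro mult_left_mono) auto
      also have "\<dots> \<le> \<theta> * m + 2 * e"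
        using \<theta> that by (simp add: algebra_simps mult_le_cancel_left1)
      finally show ?thesis .
    qed
    have "m \<le> \<theta> * m"
    proof (rule field_le_epsilon)
      fix e :: real assume "0 < e"
      then show "m \<le> \<theta> * m + e" using m_le[of "e/2"] by simp
    qed
    then have "(1 - \<theta>) * m \<le> 0" by (simp add: algebra_simps)
    then have "m \<le> 0"
      using \<theta>(2) by (simp add: mult_le_0_iff)
    have "\<exists>T. B \<subseteq> T \<and> T \<in> lmeasurable \<and> measure lebesgue T \<le> e" if "0 < e" for e
    proof -
      have "m < e" using \<open>m \<le> 0\<close> that by simp
      then show ?thesis using near by (meson less_imp_le)
    qed
    then show ?thesis by (simp add: negligible_outer_le)
  qed
  \<comment> \<open>Exhaustion by balls reduces to the bounded case, since holes of \<open>B\<close>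
    are holes of every subset.\<close>
  have "negligible (B \<inter> ball 0 (real n))" for n
  proof (rule bdd)
    show "bounded (B \<inter> ball 0 (real n))" by (simp add: bounded_Int)
    show "\<exists>r y. 0 < r \<and> r < d \<and> ball y (c * r) \<subseteq> ball x r \<and> ball y (c * r) \<inter> (B \<inter> ball 0 (real n)) = {}"
      if "x \<in> B \<inter> ball 0 (real n)" "0 < d" for x d
      using hole[of x d] that by blast
  qed
  then have "negligible (\<Union>n. B \<inter> ball 0 (real n))"
    by (intro negligible_countable_Union) auto
  moreover have "(\<Union>n. B \<inter> ball 0 (real n)) = B"
    using reals_Archimedean2 by auto
  ultimately show ?thesis by simp
qed

lemma Lip_locE:
  assumes "u \<in> Lip_loc \<Omega>" "x \<in> \<Omega>" "open \<Omega>"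
  obtains r L where "r > 0" "L > 0" "ball x r \<subseteq> \<Omega>" "\<And>y z. y \<in> ball x r \<Longrightarrow> z \<in> ball x r \<Longrightarrow> \<bar>u y - u z\<bar> \<le> L * norm (y - z)"
proof -
  obtain r L where rL: "r > 0" "L-lipschitz_on (ball x r \<inter> \<Omega>) u"
    using assms by (auto simp: Lip_loc_def)
  obtain s where s: "s > 0" "ball x s \<subseteq> \<Omega>"
    using assms by (meson openE)
  \<comment> \<open>The radius is cut down to stay inside \<open>\<Omega>\<close>, and the Lipschitz
    constant is raised by 1 to be positive, because it is used as a divisor later.\<close>
  show thesis
  proof (rule that[of "min r s" "L + 1"])
    show "0 < L + 1" using lipschitz_on_nonneg[OF rL(2)] by simp
    fix y z assume "y \<in> ball x (min r s)" "z \<in> ball x (min r s)"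
    then have "y \<in> ball x r \<inter> \<Omega>" "z \<in> ball x r \<inter> \<Omega>" using s by auto
    then have "\<bar>u y - u z\<bar> \<le> L * norm (y - z)"
      using lipschitz_onD[OF rL(2)] by (simp add: dist_norm)
    also have "\<dots> \<le> (L + 1) * norm (y - z)" by (simp add: algebra_simps)
    finally show "\<bar>u y - u z\<bar> \<le> (L + 1) * norm (y - z)" .
  qed (use rL s in auto)
qed

text \<open>
  A zero of \<open>w\<close> at which \<open>w\<close> does not have derivative \<open>0\<close> is approached by points \<open>y\<close> with
  \<open>\<bar>w y\<bar> > \<epsilon> \<parallel>y - x\<parallel>\<close>; the Lipschitz bound turns these into holes of the zero set.
\<close>

lemma Lip_loc_zero_derivative:
  assumes "open \<Omega>" and w: "w \<in> Lip_loc \<Omega>"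
  shows "negligible {x \<in> \<Omega>. w x = 0 \<and> \<not> (w has_derivative (\<lambda>_. 0)) (at x)}"
proof -
  define Z where "Z = {x \<in> \<Omega>. w x = 0}"
  \<comment> \<open>The porosity constant depends on the point through \<epsilon> and the local
    Lipschitz constant. Restricting it to the values \<open>1 / real (Suc k)\<close> leaves a
    countable union of uniformly porous sets.\<close>
  define B where "B k = {x \<in> Z. \<forall>d>0. \<exists>r y. 0 < r \<and> r < d \<and>
      ball y (1 / real (Suc k) * r) \<subseteq> ball x r \<and> ball y (1 / real (Suc k) * r) \<inter> Z = {}}" for k
  have "negligible (B k)" for k
  proof (rule porous_negligible)
    show "0 < 1 / real (Suc k)" "1 / real (Suc k) \<le> 1" by auto
    show "\<exists>r y. 0 < r \<and> r < d \<and> ball y (1 / real (Suc k) * r) \<subseteq> ball x r \<and> ball y (1 / real (Suc k) * r) \<inter> B k = {}"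
      if x: "x \<in> B k" and d: "0 < d" for x d
    proof -
      obtain r y where ry: "0 < r" "r < d" "ball y (1 / real (Suc k) * r) \<subseteq> ball x r"
          "ball y (1 / real (Suc k) * r) \<inter> Z = {}"
        using x d unfolding B_def mem_Collect_eq by metis
      moreover have "B k \<subseteq> Z" by (simp only: B_def Collect_subset)
      ultimately show ?thesis by (metis disjoint_iff subset_eq)
    qed
  qed
  then have "negligible (\<Union>k. B k)"
    by (intro negligible_countable_Union) auto
  moreover have "{x \<in> \<Omega>. w x = 0 \<and> \<not> (w has_derivative (\<lambda>_. 0)) (at x)} \<subseteq> (\<Union>k. B k)"
  proof clarify
    fix x assume x: "x \<in> \<Omega>" "w x = 0" and nd: "\<not> (w has_derivative (\<lambda>_. 0)) (at x)"
    obtain \<rho> L where L: "\<rho> > 0" "L > 0" "ball x \<rho> \<subseteq> \<Omega>"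
        "\<And>y z. y \<in> ball x \<rho> \<Longrightarrow> z \<in> ball x \<rho> \<Longrightarrow> \<bar>w y - w z\<bar> \<le> L * norm (y - z)"
      using Lip_locE[OF w x(1) assms(1)] by metis
    obtain \<epsilon> where \<epsilon>: "\<epsilon> > 0" "\<And>d. d > 0 \<Longrightarrow> \<exists>y. norm (y - x) < d \<and> \<bar>w y\<bar> > \<epsilon> * norm (y - x)"
      using nd unfolding has_derivative_at_alt by (auto simp: x bounded_linear_zero not_le)
    \<comment> \<open>With \<open>r = 2 * norm (y - x)\<close>, the bound by \<epsilon> / L / 2
      keeps \<open>w\<close> nonzero on the hole around \<open>y\<close>, and the bound by 1 / 2
      keeps the hole inside \<open>ball x r\<close>.\<close>
    obtain k where k: "1 / real (Suc k) < min (\<epsilon> / L / 2) (1 / 2)"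
      using \<epsilon>(1) L(2) nat_approx_posE[of "min (\<epsilon> / L / 2) (1 / 2)"] by auto
    have "x \<in> B k"
      unfolding B_def
    proof (clarsimp simp only: mem_Collect_eq, intro conjI allI impI)
      show "x \<in> Z" using x by (simp add: Z_def)
      fix d :: real assume "d > 0"
      \<comment> \<open>The halves ensure that \<open>r\<close> is below both \<open>d\<close> and
        \<rho>, so the hole lies where the Lipschitz estimate is valid.\<close>
      then obtain y where y: "norm (y - x) < min (d/2) (\<rho>/2)" "\<bar>w y\<bar> > \<epsilon> * norm (y - x)"
        using \<epsilon>(2)[of "min (d/2) (\<rho>/2)"] L(1) by auto
      define r where "r = 2 * norm (y - x)"
      have yx: "norm (y - x) > 0" using y(2) x by (cases "y = x") auto
      have c1: "1 / real (Suc k) * r < \<epsilon> / L / 2 * r" "1 / real (Suc k) * r < 1 / 2 * r"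
        using k yx by (intro mult_strict_right_mono; simp add: r_def)+
      have sub: "ball y (1 / real (Suc k) * r) \<subseteq> ball x r"
      proof
        fix z assume "z \<in> ball y (1 / real (Suc k) * r)"
        then have "dist y z < 1 / 2 * r" using c1(2) unfolding mem_ball by (rule less_trans)
        moreover have "dist x y = r / 2" by (simp add: r_def dist_norm norm_minus_commute)
        ultimately show "z \<in> ball x r" using dist_triangle[of x z y] by simp
      qed
      have "ball y (1 / real (Suc k) * r) \<inter> Z = {}"
      proof (rule ccontr)
        assume "\<not> ?thesis"
        then obtain z where z: "z \<in> ball y (1 / real (Suc k) * r)" "z \<in> Z" by auto
        have "z \<in> ball x \<rho>" "y \<in> ball x \<rho>"
          using sub z y L(1) by (auto simp: r_def dist_norm norm_minus_commute subset_iff)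
        then have "\<bar>w y - w z\<bar> \<le> L * norm (y - z)" using L(4) by blast
        also have "\<dots> \<le> L * (1 / real (Suc k) * r)"
          using z L(2) by (intro mult_left_mono) (auto simp: dist_norm)
        also have "\<dots> < L * (\<epsilon> / L / 2 * r)"
          using c1 L(2) by (intro mult_strict_left_mono) auto
        also have "\<dots> = \<epsilon> * norm (y - x)" using L(2) by (simp add: r_def)
        finally show False using y(2) z by (simp add: Z_def)
      qed
      then show "\<exists>r y. 0 < r \<and> r < d \<and> ball y (1 / real (Suc k) * r) \<subseteq> ball x r \<and>
          ball y (1 / real (Suc k) * r) \<inter> Z = {}"
        using sub yx y(1) by (intro exI[of _ r] exI[of _ y]) (simp add: r_def)
    qed
    then show "x \<in> (\<Union>k. B k)" by blast
  qed
  ultimately show ?thesis by (rule negligible_subset)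
qed

section \<open>Gradients of maxima and minima\<close>

text \<open>Adding or subtracting \<open>h\<close> preserves every derivative of \<open>f\<close> at
  \<open>x\<close>, so \<open>f\<close> may fail to be differentiable there: both gradients then
  take the default value 0.\<close>

lemma grad_add_zero:
  assumes h: "(h has_derivative (\<lambda>_. 0)) (at x)"
  shows "grad (\<lambda>y. f y + h y) x = grad f x"
proof -
  have *: "((\<lambda>y. f y + h y) has_derivative D) (at x) \<longleftrightarrow> (f has_derivative D) (at x)" for D
    using has_derivative_add[OF _ h, of f D] has_derivative_diff[OF _ h, of "\<lambda>y. f y + h y" D] by auto
  then have "gderiv (\<lambda>y. f y + h y) x = gderiv f x"
    by (simp add: fun_eq_iff gderiv_def)
  then show ?thesis by (simp add: grad_def differentiable_def *)
qed

lemma grad_cong_eventually: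
  assumes "open S" "x \<in> S" "\<And>y. y \<in> S \<Longrightarrow> f y = g y"
  shows "grad f x = grad g x"
proof -
  have *: "(f has_derivative D) (at x) \<longleftrightarrow> (g has_derivative D) (at x)" for D
    using has_derivative_transform_within_open[OF _ assms(1,2)] assms(3) by metis
  then have "gderiv f x = gderiv g x"
    by (simp add: fun_eq_iff gderiv_def)
  then show ?thesis by (simp add: grad_def differentiable_def *)
qed

section \<open>Continuity and lattice stability of locally Lipschitz functions\<close>

lemma Lip_loc_continuous_on:
  assumes "open \<Omega>" "u \<in> Lip_loc \<Omega>"
  shows "continuous_on \<Omega> u"
proof (rule continuous_at_imp_continuous_on, rule ballI)
  fix x assume "x \<in> \<Omega>"
  then obtain r L where "r > 0" "L-lipschitz_on (ball x r \<inter> \<Omega>) u"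
    using assms by (auto simp: Lip_loc_def)
  then have "continuous_on (ball x r \<inter> \<Omega>) u"
    using lipschitz_on_continuous_on by blast
  then show "isCont u x"
    using \<open>x \<in> \<Omega>\<close> \<open>r > 0\<close> assms(1) by (simp add: continuous_on_eq_continuous_at open_Int)
qed

text \<open>The condition on \<open>f\<close> is shared by maximum, minimum and subtraction, so one
  argument serves all three.\<close>

lemma Lip_loc_binary:
  assumes u: "u \<in> Lip_loc \<Omega>" and v: "v \<in> Lip_loc \<Omega>"
    and f: "\<And>a b c d :: real. \<bar>f a b - f c d\<bar> \<le> \<bar>a - c\<bar> + \<bar>b - d\<bar>"
  shows "(\<lambda>x. f (u x) (v x)) \<in> Lip_loc \<Omega>"
  unfolding Lip_loc_def
proof (clarsimp)
  fix x assume "x \<in> \<Omega>"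
  then obtain r L s K where r: "r > 0" "L-lipschitz_on (ball x r \<inter> \<Omega>) u"
    and s: "s > 0" "K-lipschitz_on (ball x s \<inter> \<Omega>) v"
    using u v by (auto simp: Lip_loc_def) metis
  have "(L + K)-lipschitz_on (ball x (min r s) \<inter> \<Omega>) (\<lambda>x. f (u x) (v x))"
  proof (rule lipschitz_onI)
    show "0 \<le> L + K" using lipschitz_on_nonneg r(2) s(2) by (metis add_nonneg_nonneg)
    fix y z assume yz: "y \<in> ball x (min r s) \<inter> \<Omega>" "z \<in> ball x (min r s) \<inter> \<Omega>"
    have "\<bar>u y - u z\<bar> \<le> L * dist y z" "\<bar>v y - v z\<bar> \<le> K * dist y z"
      using lipschitz_onD[OF r(2), of y z] lipschitz_onD[OF s(2), of y z] yz by (auto simp: dist_real_def)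
    then show "dist (f (u y) (v y)) (f (u z) (v z)) \<le> (L + K) * dist y z"
      using f[of "u y" "v y" "u z" "v z"] by (simp add: dist_real_def algebra_simps)
  qed
  then show "\<exists>r>0. \<exists>L. L-lipschitz_on (ball x r \<inter> \<Omega>) (\<lambda>x. f (u x) (v x))"
    using r(1) s(1) by (metis min_less_iff_conj)
qed

lemma Lip_loc_max: "u \<in> Lip_loc \<Omega> \<Longrightarrow> v \<in> Lip_loc \<Omega> \<Longrightarrow> (\<lambda>x. max (u x) (v x)) \<in> Lip_loc \<Omega>"
  by (rule Lip_loc_binary[where f = max]) (auto simp: max_def)

lemma Lip_loc_min: "u \<in> Lip_loc \<Omega> \<Longrightarrow> v \<in> Lip_loc \<Omega> \<Longrightarrow> (\<lambda>x. min (u x) (v x)) \<in> Lip_loc \<Omega>"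
  by (rule Lip_loc_binary[where f = min]) (auto simp: min_def)

text \<open>Off the coincidence set, continuity makes the maximum and minimum agree with
  \<open>u\<close> or \<open>v\<close> on a neighbourhood. On it, they differ from \<open>v\<close>
  and \<open>u\<close> by \<open>max 0 w\<close> up to sign, and \<open>w = u - v\<close> has
  derivative 0 at almost every zero. The choice made at ties matches this decomposition.\<close>

lemma grad_max_min_AE:
  assumes "open \<Omega>" and u: "u \<in> Lip_loc \<Omega>" and v: "v \<in> Lip_loc \<Omega>"
  shows "AE x in lebesgue_on \<Omega>.
    (grad (\<lambda>y. max (u y) (v y)) x = grad (if u x \<le> v x then v else u) x) \<and>
    (grad (\<lambda>y. min (u y) (v y)) x = grad (if u x \<le> v x then u else v) x)"
proof -
  define w where "w x = u x - v x" for x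
  have w: "w \<in> Lip_loc \<Omega>"
    unfolding w_def by (rule Lip_loc_binary[OF u v, where f = "(-)"]) auto
  have cw: "continuous_on \<Omega> w"
    using Lip_loc_continuous_on[OF assms(1) w] .
  define N where "N = {x \<in> \<Omega>. w x = 0 \<and> \<not> (w has_derivative (\<lambda>_. 0)) (at x)}"
  have N: "N \<in> null_sets lebesgue"
    using Lip_loc_zero_derivative[OF assms(1) w] by (simp add: N_def negligible_iff_null_sets)
  have key: "grad (\<lambda>y. max (u y) (v y)) x = grad (if u x \<le> v x then v else u) x \<and>
    grad (\<lambda>y. min (u y) (v y)) x = grad (if u x \<le> v x then u else v) x"
    if x: "x \<in> \<Omega>" "x \<notin> N" for x
  proof -
    consider "u x < v x" | "v x < u x" | "u x = v x" by linarith
    then show ?thesis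
    proof cases
      case 1
      have "open (\<Omega> \<inter> w -` {..<0})"
        using cw assms(1) by (intro continuous_open_preimage) auto
      then show ?thesis
        using 1 x by (auto simp: w_def intro!: grad_cong_eventually[of "\<Omega> \<inter> w -` {..<0}"])
    next
      case 2
      have "open (\<Omega> \<inter> w -` {0<..})"
        using cw assms(1) by (intro continuous_open_preimage) auto
      then show ?thesis
        using 2 x by (auto simp: w_def intro!: grad_cong_eventually[of "\<Omega> \<inter> w -` {0<..}"])
    next
      case 3
      then have wx: "w x = 0" by (simp add: w_def)
      then have d: "(w has_derivative (\<lambda>_. 0)) (at x)"
        using x by (auto simp: N_def)
      \<comment> \<open>Since \<open>w x = 0\<close> and the absolute value of
        \<open>max 0 (w y)\<close> is at most that of \<open>w y\<close>, the positive part inherits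
        the zero derivative.\<close>
      have p: "((\<lambda>y. max 0 (w y)) has_derivative (\<lambda>_. 0)) (at x)"
        using d wx unfolding has_derivative_at_alt
        by simp (smt (verit, ccfv_SIG))
      have n: "((\<lambda>y. - max 0 (w y)) has_derivative (\<lambda>_. 0)) (at x)"
        using has_derivative_minus[OF p] by simp
      have "(\<lambda>y. max (u y) (v y)) = (\<lambda>y. v y + max 0 (w y))" "(\<lambda>y. min (u y) (v y)) = (\<lambda>y. u y + - max 0 (w y))"
        by (auto simp: w_def fun_eq_iff)
      then show ?thesis
        using grad_add_zero[OF p, of v] grad_add_zero[OF n, of u] 3 by simp
    qed
  qed
  have "AE x in lebesgue. x \<notin> N" using N by (rule AE_not_in)
  then show ?thesis
    using assms(1) key by (subst AE_restrict_space_iff) auto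
qed

text \<open>
  Nothing is assumed about measurability of \<open>f\<close>: the integral is a supremum over simple functions,
  which can be cut along \<open>A\<close>. This spares us the measurability of gradients.
\<close>

lemma nn_integral_split_set:
  assumes A: "A \<in> sets M"
  shows "integral\<^sup>N M f = (\<integral>\<^sup>+x. f x * indicator A x \<partial>M) + (\<integral>\<^sup>+x. f x * indicator (- A) x \<partial>M)"
proof (rule antisym)
  show "integral\<^sup>N M f \<le> (\<integral>\<^sup>+x. f x * indicator A x \<partial>M) + (\<integral>\<^sup>+x. f x * indicator (- A) x \<partial>M)"
    unfolding nn_integral_def[of M f]
  proof (rule SUP_least)
    fix g assume g: "g \<in> {g. simple_function M g \<and> g \<le> f}"
    have [measurable]: "g \<in> borel_measurable M" using g by (simp add: borel_measurable_simple_function)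
    have gm: "(\<lambda>x. g x * indicator (- A) x) \<in> borel_measurable M"
    proof -
      have "(\<lambda>x. g x * indicator (space M - A) x) \<in> borel_measurable M" using A by measurable
      then show ?thesis by (subst measurable_cong[of M _ "\<lambda>x. g x * indicator (space M - A) x"])
         (auto simp: indicator_def)
    qed
    have "integral\<^sup>S M g = (\<integral>\<^sup>+x. g x \<partial>M)"
      using g by (simp add: nn_integral_eq_simple_integral)
    also have "\<dots> = (\<integral>\<^sup>+x. g x * indicator A x + g x * indicator (- A) x \<partial>M)"
      by (intro nn_integral_cong) (auto simp: indicator_def)
    also have "\<dots> = (\<integral>\<^sup>+x. g x * indicator A x \<partial>M) + (\<integral>\<^sup>+x. g x * indicator (- A) x \<partial>M)"
      using A gm by (intro nn_integral_add) auto
    also have "\<dots> \<le> (\<integral>\<^sup>+x. f x * indicator A x \<partial>M) + (\<integral>\<^sup>+x. f x * indicator (- A) x \<partial>M)"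
      using g by (intro add_mono nn_integral_mono mult_right_mono) (auto simp: le_fun_def)
    finally show "integral\<^sup>S M g \<le> (\<integral>\<^sup>+x. f x * indicator A x \<partial>M) + (\<integral>\<^sup>+x. f x * indicator (- A) x \<partial>M)" .
  qed
  \<comment> \<open>The bounds force \<open>g\<close> to vanish off \<open>A\<close> and
    \<open>h\<close> to vanish on \<open>A\<close>, so their sum is a simple function below
    \<open>f\<close>. The two suprema are then taken one after the other.\<close>
  have sup: "integral\<^sup>S M g + integral\<^sup>S M h \<le> integral\<^sup>N M f"
    if g: "simple_function M g" "g \<le> (\<lambda>x. f x * indicator A x)"
      and h: "simple_function M h" "h \<le> (\<lambda>x. f x * indicator (- A) x)" for g h
  proof -
    have "integral\<^sup>S M g + integral\<^sup>S M h = integral\<^sup>S M (\<lambda>x. g x + h x)"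
      using g h by simp
    also have "\<dots> = (\<integral>\<^sup>+x. g x + h x \<partial>M)"
      using g h by (simp add: nn_integral_eq_simple_integral)
    also have "\<dots> \<le> integral\<^sup>N M f"
    proof (rule nn_integral_mono)
      fix x
      have "g x \<le> f x * indicator A x" "h x \<le> f x * indicator (- A) x"
        using g h by (auto simp: le_fun_def)
      then show "g x + h x \<le> f x" by (cases "x \<in> A") auto
    qed
    finally show ?thesis .
  qed
  have ne: "{g. simple_function M g \<and> g \<le> F} \<noteq> {}" for F :: "'a \<Rightarrow> ennreal"
    by (auto intro!: exI[of _ "\<lambda>_. 0"] simp: le_fun_def)
  have "integral\<^sup>S M g + (\<integral>\<^sup>+x. f x * indicator (- A) x \<partial>M) \<le> integral\<^sup>N M f"
    if "simple_function M g" "g \<le> (\<lambda>x. f x * indicator A x)" for g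
    unfolding nn_integral_def[of M "\<lambda>x. f x * indicator (- A) x"] ennreal_SUP_add_right[OF ne]
    using sup that by (intro SUP_least) auto
  then show "(\<integral>\<^sup>+x. f x * indicator A x \<partial>M) + (\<integral>\<^sup>+x. f x * indicator (- A) x \<partial>M) \<le> integral\<^sup>N M f"
    unfolding nn_integral_def[of M "\<lambda>x. f x * indicator A x"] ennreal_SUP_add_left[OF ne, symmetric]
    by (intro SUP_least) auto
qed

section \<open>Energy identity for maxima and minima\<close>

definition grad_energy :: "(real^'n) set \<Rightarrow> (real^'n \<Rightarrow> real) \<Rightarrow> (real^'n \<Rightarrow> real) \<Rightarrow> ennreal" where
  "grad_energy \<Omega> p u = (\<integral>\<^sup>+ x. ennreal (norm (grad u x) powr p x) \<partial>lebesgue_on \<Omega>)"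

text \<open>Splitting along \<open>A\<close>, the set where \<open>u \<le> v\<close>, the four
  pieces of energy on the left are those on the right in another order.\<close>

lemma grad_energy_max_min:
  assumes "open \<Omega>" and u: "u \<in> Lip_loc \<Omega>" and v: "v \<in> Lip_loc \<Omega>"
  shows "grad_energy \<Omega> p (\<lambda>x. max (u x) (v x)) + grad_energy \<Omega> p (\<lambda>x. min (u x) (v x)) =
    grad_energy \<Omega> p u + grad_energy \<Omega> p v"
proof -
  let ?M = "lebesgue_on \<Omega>"
  define A where "A = {x \<in> \<Omega>. u x \<le> v x}"
  have m: "f \<in> borel_measurable ?M" if "f \<in> Lip_loc \<Omega>" for f
    using Lip_loc_continuous_on[OF assms(1) that] assms(1)
    by (intro continuous_imp_measurable_on_sets_lebesgue) auto
  have A: "A \<in> sets ?M"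
  proof -
    have "{x \<in> space ?M. u x \<le> v x} \<in> sets ?M"
      using m[OF u] m[OF v] by measurable
    then show ?thesis by (simp add: A_def)
  qed
  define e where "e w x = ennreal (norm (grad w x) powr p x)" for w x
  have E: "grad_energy \<Omega> p w = (\<integral>\<^sup>+ x. e w x * indicator A x \<partial>?M) + (\<integral>\<^sup>+ x. e w x * indicator (- A) x \<partial>?M)" for w
    unfolding grad_energy_def e_def by (rule nn_integral_split_set[OF A])
  have AE: "AE x in ?M. x \<in> \<Omega> \<and> grad (\<lambda>y. max (u y) (v y)) x = grad (if u x \<le> v x then v else u) x \<and>
    grad (\<lambda>y. min (u y) (v y)) x = grad (if u x \<le> v x then u else v) x"
    using grad_max_min_AE[OF assms] AE_space[of ?M] by eventually_elim auto
  have "(\<integral>\<^sup>+ x. e (\<lambda>x. max (u x) (v x)) x * indicator A x \<partial>?M) = (\<integral>\<^sup>+ x. e v x * indicator A x \<partial>?M)"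
       "(\<integral>\<^sup>+ x. e (\<lambda>x. max (u x) (v x)) x * indicator (-A) x \<partial>?M) = (\<integral>\<^sup>+ x. e u x * indicator (-A) x \<partial>?M)"
       "(\<integral>\<^sup>+ x. e (\<lambda>x. min (u x) (v x)) x * indicator A x \<partial>?M) = (\<integral>\<^sup>+ x. e u x * indicator A x \<partial>?M)"
       "(\<integral>\<^sup>+ x. e (\<lambda>x. min (u x) (v x)) x * indicator (-A) x \<partial>?M) = (\<integral>\<^sup>+ x. e v x * indicator (-A) x \<partial>?M)"
    by (intro nn_integral_cong_AE; use AE in \<open>eventually_elim, auto simp: A_def e_def indicator_def\<close>)+
  then show ?thesis by (simp add: E ac_simps)
qed

lemma ennreal_Liminf_add_le:
  fixes f g :: "nat \<Rightarrow> ennreal"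
  shows "liminf f + liminf g \<le> liminf (\<lambda>i. f i + g i)"
proof -
  have mono: "incseq (\<lambda>n. INF i\<in>{n..}. h i)" for h :: "nat \<Rightarrow> ennreal"
    by (auto intro!: incseq_SucI INF_superset_mono)
  have "liminf f + liminf g = (SUP n. (INF i\<in>{n..}. f i) + (INF i\<in>{n..}. g i))"
    unfolding liminf_SUP_INF using ennreal_SUP_add[OF mono mono] by simp
  also have "\<dots> \<le> (SUP n. INF i\<in>{n..}. f i + g i)"
    by (intro SUP_mono' INF_greatest add_mono INF_lower) auto
  finally show ?thesis unfolding liminf_SUP_INF .
qed

section \<open>Modulars for bounded exponents\<close>

text \<open>A real bound \<open>P\<close> stands in for the essential supremum, so that it can
  appear as an exponent in constants such as \<open>2 powr P\<close>.\<close>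

locale bounded_exponent =
  fixes \<Omega> :: "(real^'n) set" and p :: "real^'n \<Rightarrow> real" and P :: real
  assumes open_dom: "open \<Omega>"
    and p_measurable [measurable]: "p \<in> borel_measurable (lebesgue_on \<Omega>)"
    and p_ge_1: "x \<in> \<Omega> \<Longrightarrow> 1 \<le> p x"
    and p_le: "AE x in lebesgue_on \<Omega>. p x \<le> P"
begin

abbreviation "M \<equiv> lebesgue_on \<Omega>"

lemma AE_exponent: "AE x in M. x \<in> \<Omega> \<and> 1 \<le> p x \<and> p x \<le> P"
  using p_le AE_space[of M] by eventually_elim (auto intro: p_ge_1)

lemma modular_mono_AE:
  assumes "AE x in M. \<bar>u x\<bar> \<le> \<bar>v x\<bar>"
  shows "modular \<Omega> p u \<le> modular \<Omega> p v"
  unfolding modular_def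
  by (rule nn_integral_mono_AE, use assms AE_exponent in \<open>eventually_elim, auto intro!: ennreal_leI powr_mono2\<close>)

lemma modular_le_cmult_AE:
  assumes [measurable]: "v \<in> borel_measurable M" and "0 \<le> c"
    and "AE x in M. \<bar>u x\<bar> powr p x \<le> c * \<bar>v x\<bar> powr p x"
  shows "modular \<Omega> p u \<le> ennreal c * modular \<Omega> p v"
proof -
  have "modular \<Omega> p u \<le> (\<integral>\<^sup>+ x. ennreal c * ennreal (\<bar>v x\<bar> powr p x) \<partial>M)"
    unfolding modular_def
    by (rule nn_integral_mono_AE, use assms(3) in eventually_elim)
      (use assms(2) in \<open>simp flip: ennreal_mult add: ennreal_leI\<close>)
  also have "\<dots> = ennreal c * modular \<Omega> p v"
    unfolding modular_def by (intro nn_integral_cmult) measurable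
  finally show ?thesis .
qed

text \<open>Exponents at least 1 give \<open>c powr p x \<le> c\<close> for
  \<open>c \<le> 1\<close>.\<close>

lemma modular_cmult_le:
  assumes u: "u \<in> borel_measurable M" and c: "0 < c" "c \<le> 1"
  shows "modular \<Omega> p (\<lambda>x. c * u x) \<le> ennreal c * modular \<Omega> p u"
proof (rule modular_le_cmult_AE[OF u])
  show "AE x in M. \<bar>c * u x\<bar> powr p x \<le> c * \<bar>u x\<bar> powr p x"
    using AE_exponent
  proof eventually_elim
    case (elim x)
    then have "c powr p x \<le> c powr 1" using c by (intro powr_mono') auto
    then show ?case using c by (auto simp: abs_mult powr_mult intro!: mult_right_mono)
  qed
qed (use c in simp)

text \<open>Boundedness of the exponent controls the reverse scaling: \<open>c powr - p x\<close> is
  at most \<open>c powr - P\<close> for \<open>c \<le> 1\<close>.\<close>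

lemma modular_divide_le:
  assumes u: "u \<in> borel_measurable M" and c: "0 < c" "c \<le> 1"
  shows "modular \<Omega> p (\<lambda>x. u x / c) \<le> ennreal (c powr - P) * modular \<Omega> p u"
proof (rule modular_le_cmult_AE[OF u])
  show "AE x in M. \<bar>u x / c\<bar> powr p x \<le> c powr - P * \<bar>u x\<bar> powr p x"
    using AE_exponent
  proof eventually_elim
    case (elim x)
    have "\<bar>u x / c\<bar> powr p x = c powr - p x * \<bar>u x\<bar> powr p x"
      using c by (simp add: abs_divide powr_divide powr_minus_divide)
    moreover have "c powr - p x \<le> c powr - P" using c elim by (intro powr_mono') auto
    ultimately show ?case by (auto intro!: mult_right_mono)
  qed
qed (use c in simp)

text \<open>A substitute for the triangle inequality: the sum of two nonnegative numbers is at most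
  twice the larger, and the factor 2 comes out with exponent at most \<open>P\<close>. Pointwise
  domination of \<open>w\<close> covers sums, differences and lattice operations alike.\<close>

lemma modular_le_add:
  assumes [measurable]: "u \<in> borel_measurable M" "v \<in> borel_measurable M"
    and le: "AE x in M. \<bar>w x\<bar> \<le> \<bar>u x\<bar> + \<bar>v x\<bar>"
  shows "modular \<Omega> p w \<le> ennreal (2 powr P) * (modular \<Omega> p u + modular \<Omega> p v)"
proof -
  have "modular \<Omega> p w \<le> (\<integral>\<^sup>+ x. ennreal (2 powr P) * (ennreal (\<bar>u x\<bar> powr p x) + ennreal (\<bar>v x\<bar> powr p x)) \<partial>M)"
    unfolding modular_def using AE_exponent le
  proof (intro nn_integral_mono_AE, eventually_elim)
    case (elim x)
    define m where "m = max \<bar>u x\<bar> \<bar>v x\<bar>"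
    have "\<bar>w x\<bar> powr p x \<le> (2 * m) powr p x"
      using elim by (intro powr_mono2) (auto simp: m_def)
    also have "\<dots> = 2 powr p x * m powr p x" by (simp add: powr_mult m_def)
    also have "\<dots> \<le> 2 powr P * (\<bar>u x\<bar> powr p x + \<bar>v x\<bar> powr p x)"
      using elim by (intro mult_mono powr_mono) (auto simp: m_def max_def)
    finally have "ennreal (\<bar>w x\<bar> powr p x) \<le> ennreal (2 powr P * (\<bar>u x\<bar> powr p x + \<bar>v x\<bar> powr p x))"
      by (rule ennreal_leI)
    then show ?case by (simp add: ennreal_mult)
  qed
  also have "\<dots> = ennreal (2 powr P) * (modular \<Omega> p u + modular \<Omega> p v)"
    unfolding modular_def by (subst nn_integral_cmult; (subst nn_integral_add)?; simp)
  finally show ?thesis .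
qed

lemma modular_max_min:
  assumes [measurable]: "u \<in> borel_measurable M" "v \<in> borel_measurable M"
  shows "modular \<Omega> p (\<lambda>x. max (u x) (v x)) + modular \<Omega> p (\<lambda>x. min (u x) (v x)) =
    modular \<Omega> p u + modular \<Omega> p v"
proof -
  have add: "modular \<Omega> p f + modular \<Omega> p g = (\<integral>\<^sup>+ x. ennreal (\<bar>f x\<bar> powr p x) + ennreal (\<bar>g x\<bar> powr p x) \<partial>M)"
    if [measurable]: "f \<in> borel_measurable M" "g \<in> borel_measurable M" for f g
    unfolding modular_def by (rule nn_integral_add[symmetric]) measurable
  show ?thesis
    by (subst (1 2) add) (auto simp: max_def min_def add.commute intro!: nn_integral_cong)
qed

text \<open>For a bounded exponent, rescaling a function changes its modular by at most a finite
  factor, so the scale \<open>l\<close> can be taken to be 1.\<close>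

lemma Lp_var_iff: "u \<in> Lp_var \<Omega> p \<longleftrightarrow> u \<in> borel_measurable M \<and> modular \<Omega> p u < \<infinity>"
proof (intro iffI conjI)
  assume "u \<in> Lp_var \<Omega> p"
  then obtain l where l: "l > 0" "modular \<Omega> p (\<lambda>x. u x / l) < \<infinity>" and [measurable]: "u \<in> borel_measurable M"
    by (auto simp: Lp_var_def)
  show "u \<in> borel_measurable M" by fact
  show "modular \<Omega> p u < \<infinity>"
  proof (cases "l \<le> 1")
    case True
    have "modular \<Omega> p (\<lambda>x. l * (u x / l)) \<le> ennreal l * modular \<Omega> p (\<lambda>x. u x / l)"
      using l True by (intro modular_cmult_le) auto
    also have "\<dots> < \<infinity>" using l by (simp add: ennreal_mult_less_top)
    finally show ?thesis using l by simp
  next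
    case False
    have "modular \<Omega> p (\<lambda>x. (u x / l) / (1 / l)) \<le> ennreal ((1 / l) powr - P) * modular \<Omega> p (\<lambda>x. u x / l)"
      using l False by (intro modular_divide_le) auto
    also have "\<dots> < \<infinity>" using l by (simp add: ennreal_mult_less_top)
    finally show ?thesis using l by simp
  qed
next
  assume "u \<in> borel_measurable M \<and> modular \<Omega> p u < \<infinity>"
  then show "u \<in> Lp_var \<Omega> p" by (auto simp: Lp_var_def intro!: exI[of _ 1])
qed

lemma Lp_var_le_add:
  assumes "u \<in> Lp_var \<Omega> p" "v \<in> Lp_var \<Omega> p" "w \<in> borel_measurable M" "\<And>x. \<bar>w x\<bar> \<le> \<bar>u x\<bar> + \<bar>v x\<bar>"
  shows "w \<in> Lp_var \<Omega> p"
proof -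
  have "modular \<Omega> p w \<le> ennreal (2 powr P) * (modular \<Omega> p u + modular \<Omega> p v)"
    using assms by (intro modular_le_add) (auto simp: Lp_var_iff)
  also have "\<dots> < \<infinity>" using assms by (simp add: Lp_var_iff ennreal_mult_less_top)
  finally show ?thesis using assms by (simp add: Lp_var_iff)
qed

lemma Lp_var_diff: "u \<in> Lp_var \<Omega> p \<Longrightarrow> v \<in> Lp_var \<Omega> p \<Longrightarrow> (\<lambda>x. u x - v x) \<in> Lp_var \<Omega> p"
  by (rule Lp_var_le_add[of u v]) (auto simp: Lp_var_iff)

lemma Lp_var_max: "u \<in> Lp_var \<Omega> p \<Longrightarrow> v \<in> Lp_var \<Omega> p \<Longrightarrow> (\<lambda>x. max (u x) (v x)) \<in> Lp_var \<Omega> p"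
  by (rule Lp_var_le_add[of u v]) (auto simp: Lp_var_iff)

lemma Lp_var_min: "u \<in> Lp_var \<Omega> p \<Longrightarrow> v \<in> Lp_var \<Omega> p \<Longrightarrow> (\<lambda>x. min (u x) (v x)) \<in> Lp_var \<Omega> p"
  by (rule Lp_var_le_add[of u v]) (auto simp: Lp_var_iff)

section \<open>Luxemburg norm against modular\<close>

lemma luxemburg_norm_le:
  assumes "u \<in> borel_measurable M" "0 < d" "d \<le> 1" "modular \<Omega> p u \<le> ennreal (d powr P)"
  shows "luxemburg_norm \<Omega> p u \<le> d"
  unfolding luxemburg_norm_def
proof (rule cInf_lower)
  have "modular \<Omega> p (\<lambda>x. u x / d) \<le> ennreal (d powr - P) * modular \<Omega> p u"
    using assms by (intro modular_divide_le) auto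
  also have "\<dots> \<le> ennreal (d powr - P) * ennreal (d powr P)"
    using assms by (intro mult_left_mono) auto
  also have "\<dots> = 1" using assms by (simp add: powr_minus flip: ennreal_mult)
  finally show "d \<in> {l. l > 0 \<and> modular \<Omega> p (\<lambda>x. u x / l) \<le> 1}" using assms by simp
  show "bdd_below {l. l > 0 \<and> modular \<Omega> p (\<lambda>x. u x / l) \<le> 1}"
    by (rule bdd_belowI[of _ 0]) simp
qed

text \<open>The infimum of an empty set of reals carries no information, so lower bounds on the
  norm, and witnesses extracted from it, rest on this. The scale \<open>m + 1\<close> works because
  \<open>m / (m + 1)\<close> is at most 1.\<close>

lemma luxemburg_set_nonempty:
  assumes "u \<in> Lp_var \<Omega> p"
  shows "{l. l > 0 \<and> modular \<Omega> p (\<lambda>x. u x / l) \<le> 1} \<noteq> {}"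
proof -
  obtain m where m: "modular \<Omega> p u = ennreal m" "0 \<le> m"
    using assms by (cases "modular \<Omega> p u") (auto simp: Lp_var_iff)
  have "modular \<Omega> p (\<lambda>x. 1 / (m + 1) * u x) \<le> ennreal (1 / (m + 1)) * modular \<Omega> p u"
    using assms m by (intro modular_cmult_le) (auto simp: Lp_var_iff)
  also have "\<dots> \<le> 1" using m by (simp flip: ennreal_mult)
  finally have "modular \<Omega> p (\<lambda>x. u x / (m + 1)) \<le> 1" by simp
  then show ?thesis using m by (auto intro!: exI[of _ "m + 1"])
qed

lemma luxemburg_norm_nonneg:
  assumes "u \<in> Lp_var \<Omega> p"
  shows "0 \<le> luxemburg_norm \<Omega> p u"
  unfolding luxemburg_norm_def using luxemburg_set_nonempty[OF assms] by (intro cInf_greatest) auto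

lemma modular_less_of_luxemburg_norm:
  assumes u: "u \<in> Lp_var \<Omega> p" and "luxemburg_norm \<Omega> p u < d" "d \<le> 1"
  shows "modular \<Omega> p u < ennreal d"
proof -
  obtain l where l: "l > 0" "l < d" "modular \<Omega> p (\<lambda>x. u x / l) \<le> 1"
    using assms(2) cInf_lessD[OF luxemburg_set_nonempty[OF u]] unfolding luxemburg_norm_def by blast
  have "modular \<Omega> p (\<lambda>x. l * (u x / l)) \<le> ennreal l * modular \<Omega> p (\<lambda>x. u x / l)"
    using l u assms(3) by (intro modular_cmult_le) (auto simp: Lp_var_iff)
  also have "\<dots> \<le> ennreal l * 1" using l by (intro mult_left_mono) auto
  also have "\<dots> < ennreal d" using l by (simp add: ennreal_lessI)
  finally show ?thesis using l by simp
qed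

text \<open>\<open>BV_modular\<close> is defined through norm convergence; this lets all later
  estimates be carried out on integrals.\<close>

lemma luxemburg_norm_tendsto_0_iff:
  assumes "\<And>i. f i \<in> Lp_var \<Omega> p"
  shows "(\<lambda>i. luxemburg_norm \<Omega> p (f i)) \<longlonglongrightarrow> 0 \<longleftrightarrow> (\<lambda>i. modular \<Omega> p (f i)) \<longlonglongrightarrow> 0"
proof
  assume L: "(\<lambda>i. luxemburg_norm \<Omega> p (f i)) \<longlonglongrightarrow> 0"
  show "(\<lambda>i. modular \<Omega> p (f i)) \<longlonglongrightarrow> 0"
  proof (rule order_tendstoI)
    fix a :: ennreal assume "0 < a"
    then obtain b where "0 < b" "b < a" using dense by blast
    then obtain e where e: "0 < e" "ennreal e < a"
      by (cases b) auto
    have "eventually (\<lambda>i. luxemburg_norm \<Omega> p (f i) < min e 1) sequentially"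
      using order_tendstoD(2)[OF L, of "min e 1"] e by simp
    then show "eventually (\<lambda>i. modular \<Omega> p (f i) < a) sequentially"
    proof eventually_elim
      case (elim i)
      then have "modular \<Omega> p (f i) < ennreal (min e 1)"
        by (intro modular_less_of_luxemburg_norm assms) auto
      also have "\<dots> \<le> ennreal e" by (intro ennreal_leI) auto
      finally show ?case using e by simp
    qed
  qed simp
next
  assume L: "(\<lambda>i. modular \<Omega> p (f i)) \<longlonglongrightarrow> 0"
  show "(\<lambda>i. luxemburg_norm \<Omega> p (f i)) \<longlonglongrightarrow> 0"
  proof (rule order_tendstoI)
    fix a :: real assume "a < 0"
    then show "eventually (\<lambda>i. a < luxemburg_norm \<Omega> p (f i)) sequentially"
      using luxemburg_norm_nonneg[OF assms] by (intro always_eventually) (metis order_less_le_trans)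
  next
    fix a :: real assume "0 < a"
    define d where "d = min (a / 2) 1"
    have d: "0 < d" "d \<le> 1" "d < a" using \<open>0 < a\<close> by (auto simp: d_def)
    have "eventually (\<lambda>i. modular \<Omega> p (f i) < ennreal (d powr P)) sequentially"
      using order_tendstoD(2)[OF L, of "ennreal (d powr P)"] d by simp
    then show "eventually (\<lambda>i. luxemburg_norm \<Omega> p (f i) < a) sequentially"
    proof eventually_elim
      case (elim i)
      then have "luxemburg_norm \<Omega> p (f i) \<le> d"
        using d assms[of i] by (intro luxemburg_norm_le) (auto simp: Lp_var_iff)
      then show ?case using d by simp
    qed
  qed
qed

section \<open>The relaxed gradient modular\<close>

lemma BV_modular_le_liminf:
  assumes "\<And>i. w i \<in> Lip_loc \<Omega>" "\<And>i. w i \<in> Lp_var \<Omega> p" "u \<in> Lp_var \<Omega> p"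
    and "(\<lambda>i. modular \<Omega> p (\<lambda>x. w i x - u x)) \<longlonglongrightarrow> 0"
  shows "BV_modular \<Omega> p u \<le> liminf (\<lambda>i. grad_energy \<Omega> p (w i))"
  unfolding BV_modular_def grad_energy_def
  using assms Lp_var_diff[OF assms(2,3)]
  by (intro Inf_lower) (auto simp: luxemburg_norm_tendsto_0_iff)

text \<open>A liminf below the bound makes the energy small for infinitely many indices, and
  convergence makes the distance small for all late ones; some index satisfies both.\<close>

lemma BV_modular_approx:
  assumes u: "u \<in> Lp_var \<Omega> p" and fin: "BV_modular \<Omega> p u < \<infinity>" and "0 < e"
  shows "\<exists>w \<in> Lip_loc \<Omega> \<inter> Lp_var \<Omega> p. modular \<Omega> p (\<lambda>x. w x - u x) < e \<and>
    grad_energy \<Omega> p w < BV_modular \<Omega> p u + e"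
proof -
  have "BV_modular \<Omega> p u < BV_modular \<Omega> p u + e"
    using fin \<open>0 < e\<close> by (cases "BV_modular \<Omega> p u"; cases e) (auto simp flip: ennreal_plus simp: ennreal_less_iff)
  then obtain v where v: "\<And>i. v i \<in> Lip_loc \<Omega>" "\<And>i. v i \<in> Lp_var \<Omega> p"
      "(\<lambda>i. luxemburg_norm \<Omega> p (\<lambda>x. v i x - u x)) \<longlonglongrightarrow> 0"
      "liminf (\<lambda>i. grad_energy \<Omega> p (v i)) < BV_modular \<Omega> p u + e"
    unfolding BV_modular_def[of \<Omega> p u] grad_energy_def Inf_less_iff by auto
  have "eventually (\<lambda>i. modular \<Omega> p (\<lambda>x. v i x - u x) < e) sequentially"
    using v(3) Lp_var_diff[OF v(2) u] \<open>0 < e\<close>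
    by (subst (asm) luxemburg_norm_tendsto_0_iff) (auto dest: order_tendstoD)
  moreover have "frequently (\<lambda>i. grad_energy \<Omega> p (v i) < BV_modular \<Omega> p u + e) sequentially"
  proof (rule ccontr)
    assume "\<not> ?thesis"
    then have "eventually (\<lambda>i. BV_modular \<Omega> p u + e \<le> grad_energy \<Omega> p (v i)) sequentially"
      by (simp add: not_frequently not_less)
    then have "BV_modular \<Omega> p u + e \<le> liminf (\<lambda>i. grad_energy \<Omega> p (v i))"
      by (rule Liminf_bounded)
    with v(4) show False by simp
  qed
  ultimately have "frequently (\<lambda>i. grad_energy \<Omega> p (v i) < BV_modular \<Omega> p u + e \<and>
      modular \<Omega> p (\<lambda>x. v i x - u x) < e) sequentially"
    by (rule frequently_eventually_frequently[rotated])
  then show ?thesis using v(1,2) by (blast dest: frequently_ex)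
qed

lemma BV_modular_approx_seq:
  assumes u: "u \<in> Lp_var \<Omega> p" and fin: "BV_modular \<Omega> p u < \<infinity>"
  obtains w where "\<And>i. w i \<in> Lip_loc \<Omega>" "\<And>i. w i \<in> Lp_var \<Omega> p"
    "(\<lambda>i. modular \<Omega> p (\<lambda>x. w i x - u x)) \<longlonglongrightarrow> 0"
    "\<And>i. grad_energy \<Omega> p (w i) \<le> BV_modular \<Omega> p u + ennreal (inverse (Suc i))"
proof -
  have "\<forall>i. \<exists>w. w \<in> Lip_loc \<Omega> \<inter> Lp_var \<Omega> p \<and> modular \<Omega> p (\<lambda>x. w x - u x) < ennreal (inverse (Suc i)) \<and>
    grad_energy \<Omega> p w < BV_modular \<Omega> p u + ennreal (inverse (Suc i))"
    using BV_modular_approx[OF u fin] by (simp add: Bex_def)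
  then obtain w where w: "\<And>i. w i \<in> Lip_loc \<Omega> \<inter> Lp_var \<Omega> p"
      "\<And>i. modular \<Omega> p (\<lambda>x. w i x - u x) < ennreal (inverse (Suc i))"
      "\<And>i. grad_energy \<Omega> p (w i) < BV_modular \<Omega> p u + ennreal (inverse (Suc i))" by metis
  have "(\<lambda>i. ennreal (inverse (Suc i))) \<longlonglongrightarrow> ennreal 0"
    by (intro tendsto_ennrealI LIMSEQ_inverse_real_of_nat)
  then have inv: "(\<lambda>i. ennreal (inverse (real (Suc i)))) \<longlonglongrightarrow> 0"
    by (simp only: ennreal_0)
  have "(\<lambda>i. modular \<Omega> p (\<lambda>x. w i x - u x)) \<longlonglongrightarrow> 0"
    by (rule tendsto_sandwich[OF _ _ tendsto_const inv])
      (use w(2) in \<open>auto intro!: always_eventually less_imp_le\<close>)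
  then show thesis using w(1) less_imp_le[OF w(3)] by (intro that[of w]) auto
qed

text \<open>Maxima and minima of near-optimal approximants of \<open>u\<close> and \<open>v\<close>
  are competitors for the maximum and minimum of the limits. The energy identity and superadditivity
  of liminf then give the bound; if a term on the right is infinite, it is trivial.\<close>

lemma BV_modular_max_min:
  assumes u: "u \<in> Lp_var \<Omega> p" and v: "v \<in> Lp_var \<Omega> p"
  shows "BV_modular \<Omega> p (\<lambda>x. max (u x) (v x)) + BV_modular \<Omega> p (\<lambda>x. min (u x) (v x)) \<le>
    BV_modular \<Omega> p u + BV_modular \<Omega> p v"
proof (cases "BV_modular \<Omega> p u < \<infinity> \<and> BV_modular \<Omega> p v < \<infinity>")
  case True
  obtain f where f: "\<And>i. f i \<in> Lip_loc \<Omega>" "\<And>i. f i \<in> Lp_var \<Omega> p"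
    "(\<lambda>i. modular \<Omega> p (\<lambda>x. f i x - u x)) \<longlonglongrightarrow> 0"
    "\<And>i. grad_energy \<Omega> p (f i) \<le> BV_modular \<Omega> p u + ennreal (inverse (Suc i))"
    using True by (blast intro: BV_modular_approx_seq[OF u])
  obtain g where g: "\<And>i. g i \<in> Lip_loc \<Omega>" "\<And>i. g i \<in> Lp_var \<Omega> p"
    "(\<lambda>i. modular \<Omega> p (\<lambda>x. g i x - v x)) \<longlonglongrightarrow> 0"
    "\<And>i. grad_energy \<Omega> p (g i) \<le> BV_modular \<Omega> p v + ennreal (inverse (Suc i))"
    using True by (blast intro: BV_modular_approx_seq[OF v])
  \<comment> \<open>Stated for general \<open>h\<close> so as to serve for both \<open>max\<close>
    and \<open>min\<close>.\<close>
  have conv: "(\<lambda>i. modular \<Omega> p (\<lambda>x. h (f i x) (g i x) - h (u x) (v x))) \<longlonglongrightarrow> 0"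
    if h: "\<And>a b c d. \<bar>h a b - h c d\<bar> \<le> \<bar>a - c\<bar> + \<bar>b - d\<bar>" for h :: "real \<Rightarrow> real \<Rightarrow> real"
  proof (rule tendsto_sandwich[OF _ _ tendsto_const])
    have "(\<lambda>i. ennreal (2 powr P) * (modular \<Omega> p (\<lambda>x. f i x - u x) + modular \<Omega> p (\<lambda>x. g i x - v x)))
      \<longlonglongrightarrow> ennreal (2 powr P) * (0 + 0)"
      by (intro ennreal_tendsto_cmult tendsto_add f g) simp
    then show "(\<lambda>i. ennreal (2 powr P) * (modular \<Omega> p (\<lambda>x. f i x - u x) + modular \<Omega> p (\<lambda>x. g i x - v x)))
      \<longlonglongrightarrow> 0" by simp
    show "\<forall>\<^sub>F i in sequentially. modular \<Omega> p (\<lambda>x. h (f i x) (g i x) - h (u x) (v x)) \<le>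
      ennreal (2 powr P) * (modular \<Omega> p (\<lambda>x. f i x - u x) + modular \<Omega> p (\<lambda>x. g i x - v x))"
      using f(2) g(2) u v h
      by (intro always_eventually allI modular_le_add borel_measurable_diff) (auto simp: Lp_var_iff)
  qed simp
  have "BV_modular \<Omega> p (\<lambda>x. max (u x) (v x)) \<le> liminf (\<lambda>i. grad_energy \<Omega> p (\<lambda>x. max (f i x) (g i x)))"
    by (intro BV_modular_le_liminf conv Lip_loc_max Lp_var_max f g u v) (auto simp: max_def)
  moreover have "BV_modular \<Omega> p (\<lambda>x. min (u x) (v x)) \<le> liminf (\<lambda>i. grad_energy \<Omega> p (\<lambda>x. min (f i x) (g i x)))"
    by (intro BV_modular_le_liminf conv Lip_loc_min Lp_var_min f g u v) (auto simp: min_def)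
  ultimately have "BV_modular \<Omega> p (\<lambda>x. max (u x) (v x)) + BV_modular \<Omega> p (\<lambda>x. min (u x) (v x)) \<le>
    liminf (\<lambda>i. grad_energy \<Omega> p (\<lambda>x. max (f i x) (g i x))) + liminf (\<lambda>i. grad_energy \<Omega> p (\<lambda>x. min (f i x) (g i x)))"
    by (rule add_mono)
  also have "\<dots> \<le> liminf (\<lambda>i. grad_energy \<Omega> p (\<lambda>x. max (f i x) (g i x)) + grad_energy \<Omega> p (\<lambda>x. min (f i x) (g i x)))"
    by (rule ennreal_Liminf_add_le)
  also have "\<dots> = liminf (\<lambda>i. grad_energy \<Omega> p (f i) + grad_energy \<Omega> p (g i))"
    using f g by (simp add: grad_energy_max_min open_dom)
  also have "\<dots> \<le> liminf (\<lambda>i. (BV_modular \<Omega> p u + ennreal (inverse (Suc i))) + (BV_modular \<Omega> p v + ennreal (inverse (Suc i))))"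
    using f(4) g(4) by (intro Liminf_mono always_eventually allI add_mono)
  also have "\<dots> = (BV_modular \<Omega> p u + ennreal 0) + (BV_modular \<Omega> p v + ennreal 0)"
    by (intro lim_imp_Liminf tendsto_add tendsto_const tendsto_ennrealI LIMSEQ_inverse_real_of_nat) simp
  finally show ?thesis by simp
qed (auto simp: less_top[symmetric])

text \<open>A diagonal argument: each \<open>v k\<close> is replaced by a locally Lipschitz
  \<open>w k\<close> within \<open>e k\<close> in both distance and energy, and the
  \<open>w k\<close> still converge to \<open>u\<close>.\<close>

lemma BV_modular_lsc:
  assumes v: "\<And>k. v k \<in> Lp_var \<Omega> p" and u: "u \<in> Lp_var \<Omega> p"
    and conv: "(\<lambda>k. modular \<Omega> p (\<lambda>x. v k x - u x)) \<longlonglongrightarrow> 0"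
    and le: "\<And>k. BV_modular \<Omega> p (v k) \<le> K" and K: "K < \<infinity>"
  shows "BV_modular \<Omega> p u \<le> K"
proof -
  define e where "e k = ennreal (inverse (Suc k))" for k
  have e0: "e \<longlonglongrightarrow> 0"
    unfolding e_def using tendsto_ennrealI[OF LIMSEQ_inverse_real_of_nat] by simp
  have "\<exists>w. w \<in> Lip_loc \<Omega> \<inter> Lp_var \<Omega> p \<and> modular \<Omega> p (\<lambda>x. w x - v k x) < e k \<and>
    grad_energy \<Omega> p w < BV_modular \<Omega> p (v k) + e k" for k
    using BV_modular_approx[OF v, of k "e k"] order_le_less_trans[OF le K] by (auto simp: e_def)
  then obtain w where w: "\<And>k. w k \<in> Lip_loc \<Omega> \<inter> Lp_var \<Omega> p"
      "\<And>k. modular \<Omega> p (\<lambda>x. w k x - v k x) < e k"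
      "\<And>k. grad_energy \<Omega> p (w k) < BV_modular \<Omega> p (v k) + e k" by metis
  have "(\<lambda>k. modular \<Omega> p (\<lambda>x. w k x - u x)) \<longlonglongrightarrow> 0"
  proof (rule tendsto_sandwich[OF _ _ tendsto_const])
    have "(\<lambda>k. ennreal (2 powr P) * (e k + modular \<Omega> p (\<lambda>x. v k x - u x))) \<longlonglongrightarrow> ennreal (2 powr P) * (0 + 0)"
      by (intro ennreal_tendsto_cmult tendsto_add conv e0) simp
    then show "(\<lambda>k. ennreal (2 powr P) * (e k + modular \<Omega> p (\<lambda>x. v k x - u x))) \<longlonglongrightarrow> 0" by simp
    have "modular \<Omega> p (\<lambda>x. w k x - u x) \<le>
        ennreal (2 powr P) * (modular \<Omega> p (\<lambda>x. w k x - v k x) + modular \<Omega> p (\<lambda>x. v k x - u x))" for k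
      using w(1)[of k] v[of k] u by (intro modular_le_add) (auto simp: Lp_var_iff)
    also have "\<dots> k \<le> ennreal (2 powr P) * (e k + modular \<Omega> p (\<lambda>x. v k x - u x))" for k
      using w(2)[of k] by (intro mult_left_mono add_right_mono) auto
    finally show "\<forall>\<^sub>F k in sequentially. modular \<Omega> p (\<lambda>x. w k x - u x) \<le>
        ennreal (2 powr P) * (e k + modular \<Omega> p (\<lambda>x. v k x - u x))"
      by (intro always_eventually allI)
  qed simp
  then have "BV_modular \<Omega> p u \<le> liminf (\<lambda>k. grad_energy \<Omega> p (w k))"
    using w(1) u by (intro BV_modular_le_liminf) auto
  also have "\<dots> \<le> liminf (\<lambda>k. K + e k)"
  proof (intro Liminf_mono always_eventually allI)
    fix k show "grad_energy \<Omega> p (w k) \<le> K + e k"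
      using order_less_le_trans[OF w(3) add_right_mono[OF le]] by (rule less_imp_le)
  qed
  also have "\<dots> = K + 0"
    by (intro lim_imp_Liminf tendsto_add tendsto_const e0) simp
  finally show ?thesis by simp
qed

section \<open>Capacity of an increasing union\<close>

definition capacity_functional :: "(real^'n \<Rightarrow> real) \<Rightarrow> ennreal" where
  "capacity_functional u = modular \<Omega> p u + BV_modular \<Omega> p u"

lemma mixed_capacity_mono: "A \<subseteq> B \<Longrightarrow> mixed_capacity \<Omega> p A \<le> mixed_capacity \<Omega> p B"
  unfolding mixed_capacity_def by (intro Inf_superset_mono) (fastforce simp: admissible_def)

lemma mixed_capacity_le: "u \<in> admissible \<Omega> p A \<Longrightarrow> mixed_capacity \<Omega> p A \<le> capacity_functional u"
  unfolding mixed_capacity_def capacity_functional_def by (intro Inf_lower) auto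

lemma mixed_capacity_approx:
  assumes "mixed_capacity \<Omega> p A < \<infinity>" "0 < e"
  shows "\<exists>u \<in> admissible \<Omega> p A. capacity_functional u \<le> mixed_capacity \<Omega> p A + e"
proof -
  have "mixed_capacity \<Omega> p A < mixed_capacity \<Omega> p A + e"
    using assms by (cases "mixed_capacity \<Omega> p A"; cases e) (auto simp flip: ennreal_plus simp: ennreal_less_iff)
  then show ?thesis
    unfolding mixed_capacity_def[of \<Omega> p A] Inf_less_iff capacity_functional_def
    by (auto intro: less_imp_le)
qed

text \<open>Guarded statements over the single measure \<open>lebesgue\<close> allow almost
  everywhere facts on different open sets to be combined directly.\<close>

lemma admissible_iff:
  "u \<in> admissible \<Omega> p A \<longleftrightarrow> u \<in> Lp_var \<Omega> p \<and> BV_modular \<Omega> p u < \<infinity> \<and>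
    (AE x in lebesgue. x \<in> \<Omega> \<longrightarrow> 0 \<le> u x \<and> u x \<le> 1) \<and>
    (\<exists>U. open U \<and> A \<subseteq> U \<and> U \<subseteq> \<Omega> \<and> (AE x in lebesgue. x \<in> U \<longrightarrow> u x = 1))"
proof -
  have "(AE x in lebesgue_on U. Q x) \<longleftrightarrow> (AE x in lebesgue. x \<in> U \<longrightarrow> Q x)" if "open U" for U :: "(real^'n) set" and Q
    using that by (subst AE_restrict_space_iff) auto
  then show ?thesis
    using open_dom by (auto simp: admissible_def BV_var_def)
qed

lemma capacity_functional_max_min:
  assumes "u \<in> Lp_var \<Omega> p" "v \<in> Lp_var \<Omega> p"
  shows "capacity_functional (\<lambda>x. max (u x) (v x)) + capacity_functional (\<lambda>x. min (u x) (v x)) \<le>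
    capacity_functional u + capacity_functional v"
proof -
  have "capacity_functional (\<lambda>x. max (u x) (v x)) + capacity_functional (\<lambda>x. min (u x) (v x)) =
    (modular \<Omega> p (\<lambda>x. max (u x) (v x)) + modular \<Omega> p (\<lambda>x. min (u x) (v x))) +
    (BV_modular \<Omega> p (\<lambda>x. max (u x) (v x)) + BV_modular \<Omega> p (\<lambda>x. min (u x) (v x)))"
    by (simp add: capacity_functional_def ac_simps)
  also have "\<dots> \<le> (modular \<Omega> p u + modular \<Omega> p v) + (BV_modular \<Omega> p u + BV_modular \<Omega> p v)"
    using assms modular_max_min[of u v]
    by (intro add_mono[OF _ BV_modular_max_min]) (auto simp: Lp_var_iff)
  finally show ?thesis by (simp add: capacity_functional_def ac_simps)
qed

text \<open>Finiteness of both relaxed energies follows from strong subadditivity, which bounds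
  their sum.\<close>

lemma admissible_max_min:
  assumes "u \<in> admissible \<Omega> p A" "v \<in> admissible \<Omega> p B"
  shows "(\<lambda>x. max (u x) (v x)) \<in> admissible \<Omega> p (A \<union> B)"
    and "(\<lambda>x. min (u x) (v x)) \<in> admissible \<Omega> p (A \<inter> B)"
proof -
  from assms obtain U V where u: "u \<in> Lp_var \<Omega> p" "BV_modular \<Omega> p u < \<infinity>"
      "AE x in lebesgue. x \<in> \<Omega> \<longrightarrow> 0 \<le> u x \<and> u x \<le> 1"
    and U: "open U" "A \<subseteq> U" "U \<subseteq> \<Omega>" "AE x in lebesgue. x \<in> U \<longrightarrow> u x = 1"
    and v: "v \<in> Lp_var \<Omega> p" "BV_modular \<Omega> p v < \<infinity>"
      "AE x in lebesgue. x \<in> \<Omega> \<longrightarrow> 0 \<le> v x \<and> v x \<le> 1"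
    and V: "open V" "B \<subseteq> V" "V \<subseteq> \<Omega>" "AE x in lebesgue. x \<in> V \<longrightarrow> v x = 1"
    unfolding admissible_iff by auto
  have "BV_modular \<Omega> p (\<lambda>x. max (u x) (v x)) + BV_modular \<Omega> p (\<lambda>x. min (u x) (v x)) < \<infinity>"
    using u(2) v(2) by (intro order_le_less_trans[OF BV_modular_max_min[OF u(1) v(1)]]) simp
  then have fin: "BV_modular \<Omega> p (\<lambda>x. max (u x) (v x)) < \<infinity>" "BV_modular \<Omega> p (\<lambda>x. min (u x) (v x)) < \<infinity>"
    by auto
  show "(\<lambda>x. max (u x) (v x)) \<in> admissible \<Omega> p (A \<union> B)"
    unfolding admissible_iff
  proof (intro conjI exI[of _ "U \<union> V"])
    show "AE x in lebesgue. x \<in> \<Omega> \<longrightarrow> 0 \<le> max (u x) (v x) \<and> max (u x) (v x) \<le> 1"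
      using u(3) v(3) by eventually_elim auto
    show "AE x in lebesgue. x \<in> U \<union> V \<longrightarrow> max (u x) (v x) = 1"
      \<comment> \<open>One function equals 1 and the other is at most 1, as \<open>U\<close> and
        \<open>V\<close> lie in \<open>\<Omega>\<close>.\<close>
      using u(3) v(3) U(4) V(4) by eventually_elim (use U(3) V(3) in \<open>auto simp: max_def\<close>)
  qed (use u v U V fin in \<open>auto intro: Lp_var_max\<close>)
  show "(\<lambda>x. min (u x) (v x)) \<in> admissible \<Omega> p (A \<inter> B)"
    unfolding admissible_iff
  proof (intro conjI exI[of _ "U \<inter> V"])
    show "AE x in lebesgue. x \<in> \<Omega> \<longrightarrow> 0 \<le> min (u x) (v x) \<and> min (u x) (v x) \<le> 1"
      using u(3) v(3) by eventually_elim auto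
    show "AE x in lebesgue. x \<in> U \<inter> V \<longrightarrow> min (u x) (v x) = 1"
      using U(4) V(4) by eventually_elim auto
  qed (use u v U V fin in \<open>auto intro: Lp_var_min\<close>)
qed

text \<open>The pointwise limit is the competitor. Fatou's lemma handles its modular, dominated
  convergence gives convergence of the sequence to it, and \<open>BV_modular_lsc\<close> handles the
  gradient part.\<close>

lemma capacity_functional_increasing_limit:
  assumes v: "\<And>i. v i \<in> admissible \<Omega> p (A i)"
    and inc: "\<And>i x. v i x \<le> v (Suc i) x"
    and le: "\<And>i. capacity_functional (v i) \<le> K" and K: "K < \<infinity>"
  shows "mixed_capacity \<Omega> p (\<Union>i. A i) \<le> K"
proof -
  have Lp: "v i \<in> Lp_var \<Omega> p" and [measurable]: "v i \<in> borel_measurable M" for i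
    using v[of i] by (auto simp: admissible_iff Lp_var_iff)
  have mono: "v i x \<le> v j x" if "i \<le> j" for i j x
    using inc that by (rule lift_Suc_mono_le[of "\<lambda>i. v i x"])
  \<comment> \<open>Where the sequence diverges, \<open>lim\<close> is an arbitrary value; inside
    \<open>\<Omega>\<close> the bounds by 0 and 1 confine this to a null set.\<close>
  define w where "w x = lim (\<lambda>i. v i x)" for x
  have [measurable]: "w \<in> borel_measurable M"
    unfolding w_def by measurable
  have bounds: "AE x in lebesgue. \<forall>i. x \<in> \<Omega> \<longrightarrow> 0 \<le> v i x \<and> v i x \<le> 1"
    using v unfolding AE_all_countable admissible_iff by blast
  have lim: "(\<lambda>i. v i x) \<longlonglongrightarrow> w x" "\<And>i. v i x \<le> w x" "0 \<le> w x" "w x \<le> 1"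
    if "\<And>i. 0 \<le> v i x \<and> v i x \<le> 1" for x
  proof -
    have inc: "incseq (\<lambda>i. v i x)" using mono by (auto simp: incseq_def)
    have "\<forall>i. v i x \<le> 1" using that by blast
    with inc obtain l where l: "(\<lambda>i. v i x) \<longlonglongrightarrow> l" "\<forall>i. v i x \<le> l"
      by (rule incseq_convergent)
    then have "w x = l" by (simp add: w_def limI)
    with l show L: "(\<lambda>i. v i x) \<longlonglongrightarrow> w x" and ge: "v i x \<le> w x" for i by auto
    show "0 \<le> w x" using ge[of 0] that[of 0] by simp
    show "w x \<le> 1" using L by (rule LIMSEQ_le_const2) (use that in auto)
  qed
  have AE_M: "AE x in M. \<forall>i. 0 \<le> v i x \<and> v i x \<le> 1"
    using bounds open_dom by (subst AE_restrict_space_iff) (auto elim: eventually_mono)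
  have mod_conv: "(\<integral>\<^sup>+ x. liminf (\<lambda>i. ennreal (\<bar>v i x\<bar> powr p x)) \<partial>M) = modular \<Omega> p w"
    unfolding modular_def
  proof (rule nn_integral_cong_AE, use AE_M AE_exponent in eventually_elim)
    case (elim x)
    have "(\<lambda>i. ennreal (\<bar>v i x\<bar> powr p x)) \<longlonglongrightarrow> ennreal (\<bar>w x\<bar> powr p x)"
      using lim(1)[of x] elim by (intro tendsto_ennrealI tendsto_powr' tendsto_intros) auto
    then show ?case by (intro lim_imp_Liminf) auto
  qed
  have mod_w: "modular \<Omega> p w \<le> liminf (\<lambda>i. modular \<Omega> p (v i))"
    unfolding mod_conv[symmetric] unfolding modular_def by (rule nn_integral_liminf) measurable
  also have "\<dots> \<le> liminf (\<lambda>i. K)"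
    using le by (intro Liminf_mono always_eventually allI)
      (metis capacity_functional_def add_increasing2 order_refl order_trans zero_le)
  also have "\<dots> = K" by (simp add: Liminf_const)
  finally have w: "w \<in> Lp_var \<Omega> p"
    using K by (simp add: Lp_var_iff order_le_less_trans)
  have conv: "(\<lambda>i. modular \<Omega> p (\<lambda>x. v i x - w x)) \<longlonglongrightarrow> 0"
  proof -
    have "(\<lambda>i. modular \<Omega> p (\<lambda>x. v i x - w x)) \<longlonglongrightarrow> (\<integral>\<^sup>+ x. 0 \<partial>M)"
      unfolding modular_def
    proof (rule nn_integral_dominated_convergence[where w = "\<lambda>x. ennreal (\<bar>w x\<bar> powr p x)"])
      show "AE x in M. ennreal (\<bar>v j x - w x\<bar> powr p x) \<le> ennreal (\<bar>w x\<bar> powr p x)" for j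
        using AE_M AE_exponent
      proof eventually_elim
        case (elim x)
        then have "0 \<le> v j x" "v j x \<le> w x" using lim(2)[of x j] by auto
        then have "\<bar>v j x - w x\<bar> \<le> \<bar>w x\<bar>" by simp
        then show ?case using elim by (intro ennreal_leI powr_mono2) auto
      qed
      show "AE x in M. (\<lambda>i. ennreal (\<bar>v i x - w x\<bar> powr p x)) \<longlonglongrightarrow> 0"
        using AE_M AE_exponent
      proof eventually_elim
        case (elim x)
        have "(\<lambda>i. \<bar>v i x - w x\<bar>) \<longlonglongrightarrow> 0"
          using lim(1)[of x] elim by (intro tendsto_rabs_zero LIM_zero) auto
        \<comment> \<open>A positive exponent is what makes the power continuous at base 0.\<close>
        then have "(\<lambda>i. \<bar>v i x - w x\<bar> powr p x) \<longlonglongrightarrow> 0 powr p x"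
          using elim by (intro tendsto_powr' tendsto_const) auto
        then show ?case using tendsto_ennrealI by fastforce
      qed
      show "(\<integral>\<^sup>+ x. ennreal (\<bar>w x\<bar> powr p x) \<partial>M) < \<infinity>"
        using w by (simp add: Lp_var_iff modular_def)
    qed measurable
    then show ?thesis by simp
  qed
  \<comment> \<open>\<open>BV_modular_lsc\<close> takes a uniform bound, whereas only the sum of the
    two modulars is bounded. Freezing the modular at index \<open>j\<close>, where by monotonicity
    it is smallest among later ones, leaves the uniform bound
    \<open>K - modular \<Omega> p (v j)\<close>.\<close>
  have sum_le: "modular \<Omega> p (v j) + BV_modular \<Omega> p w \<le> K" for j
  proof -
    have mono_mod: "modular \<Omega> p (v j) \<le> modular \<Omega> p (v (j + k))" for k
    proof (rule modular_mono_AE, use AE_M in eventually_elim)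
      case (elim x)
      then have "0 \<le> v j x" "v j x \<le> v (j + k) x" using mono[of j "j + k" x] by auto
      then show ?case by simp
    qed
    have fin: "modular \<Omega> p (v j) < \<infinity>" using Lp by (simp add: Lp_var_iff)
    have "BV_modular \<Omega> p w \<le> K - modular \<Omega> p (v j)"
    proof (rule BV_modular_lsc[where v = "\<lambda>k. v (j + k)"])
      show "(\<lambda>k. modular \<Omega> p (\<lambda>x. v (j + k) x - w x)) \<longlonglongrightarrow> 0"
        using LIMSEQ_ignore_initial_segment[OF conv, of j] by (simp add: add.commute)
      fix k
      have "modular \<Omega> p (v j) + BV_modular \<Omega> p (v (j + k)) \<le> K"
        using le[of "j + k"] add_right_mono[OF mono_mod[of k]] unfolding capacity_functional_def
        by (rule order_trans[rotated])
      then show "BV_modular \<Omega> p (v (j + k)) \<le> K - modular \<Omega> p (v j)"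
        using fin by (simp add: ennreal_le_minus_iff add.commute)
    next
      show "K - modular \<Omega> p (v j) < \<infinity>" using K by (simp add: diff_less_top_ennreal)
    qed (use Lp w in auto)
    \<comment> \<open>Subtraction in \<open>ennreal\<close> truncates at 0; this comparison allows
      it to be undone.\<close>
    moreover have "modular \<Omega> p (v j) \<le> K"
      using le[of j] unfolding capacity_functional_def by (rule order_trans[rotated]) simp
    ultimately show ?thesis
      using fin by (metis add_left_mono add_diff_inverse_ennreal)
  qed
  have "capacity_functional w \<le> liminf (\<lambda>i. modular \<Omega> p (v i)) + BV_modular \<Omega> p w"
    unfolding capacity_functional_def using mod_w by (rule add_right_mono)
  also have "\<dots> = liminf (\<lambda>i. modular \<Omega> p (v i) + BV_modular \<Omega> p w)"
    by (rule Liminf_add_const[symmetric]) simp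
  also have "\<dots> \<le> liminf (\<lambda>i. K)"
    using sum_le by (intro Liminf_mono always_eventually allI)
  finally have "capacity_functional w \<le> K" by (simp add: Liminf_const)
  moreover have "w \<in> admissible \<Omega> p (\<Union>i. A i)"
  proof -
    have "\<forall>i. \<exists>U. open U \<and> A i \<subseteq> U \<and> U \<subseteq> \<Omega> \<and> (AE x in lebesgue. x \<in> U \<longrightarrow> v i x = 1)"
      using v unfolding admissible_iff by blast
    then obtain U where U: "\<And>i. open (U i)" "\<And>i. A i \<subseteq> U i" "\<And>i. U i \<subseteq> \<Omega>"
        "\<And>i. AE x in lebesgue. x \<in> U i \<longrightarrow> v i x = 1" by metis
    then have one: "AE x in lebesgue. \<forall>i. x \<in> U i \<longrightarrow> v i x = 1"
      by (simp add: AE_all_countable)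
    show ?thesis
      unfolding admissible_iff
    proof (intro conjI exI[of _ "\<Union>i. U i"])
      show "AE x in lebesgue. x \<in> \<Omega> \<longrightarrow> 0 \<le> w x \<and> w x \<le> 1"
        using bounds by eventually_elim (use lim in blast)
      show "AE x in lebesgue. x \<in> (\<Union>i. U i) \<longrightarrow> w x = 1"
        using bounds one
      proof eventually_elim
        case (elim x)
        show ?case
        proof
          assume "x \<in> (\<Union>i. U i)"
          then obtain i where i: "x \<in> U i" by blast
          then have "\<And>j. 0 \<le> v j x \<and> v j x \<le> 1" using elim U(3) by blast
          then have "v i x \<le> w x" "w x \<le> 1" using lim[of x] by blast+
          then show "w x = 1" using elim i by auto
        qed
      qed
      show "BV_modular \<Omega> p w < \<infinity>"
        using sum_le[of 0] K by (metis add_increasing order_refl order_trans zero_le order_le_less_trans)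
      show "open (\<Union>i. U i)" using U(1) by blast
      show "(\<Union>i. A i) \<subseteq> (\<Union>i. U i)" using U(2) by blast
      show "(\<Union>i. U i) \<subseteq> \<Omega>" using U(3) by blast
    qed (fact w)
  qed
  ultimately show ?thesis using mixed_capacity_le order_trans by blast
qed

text \<open>Running maxima of near-optimal functions keep the total error below \<open>e\<close>, so
  their increasing limit competes for the union.\<close>

lemma mixed_capacity_Union_le:
  assumes inc: "\<And>i. E i \<subseteq> E (Suc i)"
    and fin: "(SUP i. mixed_capacity \<Omega> p (E i)) < \<infinity>"
  shows "mixed_capacity \<Omega> p (\<Union>i. E i) \<le> (SUP i. mixed_capacity \<Omega> p (E i))"
proof (rule ennreal_le_epsilon)
  fix e :: real assume e: "0 < e"
  let ?C = "\<lambda>i. mixed_capacity \<Omega> p (E i)"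
  have C_le: "?C i \<le> (SUP i. ?C i)" for i by (rule SUP_upper) simp
  have C_fin: "?C i < \<infinity>" for i using C_le fin by (rule order_le_less_trans)
  \<comment> \<open>Geometric errors with exponent \<open>Suc i\<close>, so that all partial sums
    stay below \<open>e\<close>.\<close>
  define d where "d i = ennreal (e * (1/2) ^ Suc i)" for i :: nat
  have "\<exists>u. u \<in> admissible \<Omega> p (E i) \<and> capacity_functional u \<le> ?C i + d i" for i
    using mixed_capacity_approx[OF C_fin, of "d i" i] e by (auto simp: d_def)
  then obtain u where u: "\<And>i. u i \<in> admissible \<Omega> p (E i)" "\<And>i. capacity_functional (u i) \<le> ?C i + d i"
    by metis
  define v where "v = rec_nat (u 0) (\<lambda>i f x. max (f x) (u (Suc i) x))"
  have v0: "v 0 = u 0" and vSuc: "v (Suc i) = (\<lambda>x. max (v i x) (u (Suc i) x))" for i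
    by (simp_all add: v_def)
  have v: "v i \<in> admissible \<Omega> p (E i)" for i
  proof (induction i)
    case (Suc i)
    have "E i \<union> E (Suc i) = E (Suc i)" using inc by blast
    then show ?case using admissible_max_min(1)[OF Suc u(1)[of "Suc i"]] by (simp add: vSuc)
  qed (simp add: v0 u)
  have v_le: "capacity_functional (v i) \<le> ?C i + (\<Sum>k\<le>i. d k)" for i
  proof (induction i)
    case (Suc i)
    let ?m = "\<lambda>x. min (v i x) (u (Suc i) x)"
    have "E i \<inter> E (Suc i) = E i" using inc by blast
    \<comment> \<open>The minimum is admissible for \<open>E i\<close> and so costs at least
      \<open>?C i\<close>. Strong subadditivity pays for this with the \<open>?C i\<close> contained
      in the bound for \<open>v i\<close>, leaving only \<open>?C (Suc i)\<close> and the
      errors.\<close>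
    then have "?C i \<le> capacity_functional ?m"
      using mixed_capacity_le[OF admissible_max_min(2)[OF v[of i] u(1)[of "Suc i"]]] by simp
    then have "?C i + capacity_functional (v (Suc i)) \<le> capacity_functional ?m + capacity_functional (v (Suc i))"
      by (rule add_right_mono)
    also have "\<dots> \<le> capacity_functional (v i) + capacity_functional (u (Suc i))"
      using capacity_functional_max_min[of "v i" "u (Suc i)"] v[of i] u(1)[of "Suc i"]
      by (simp add: vSuc admissible_iff add.commute)
    also have "\<dots> \<le> (?C i + (\<Sum>k\<le>i. d k)) + (?C (Suc i) + d (Suc i))"
      using Suc u(2) by (intro add_mono)
    also have "\<dots> = ?C i + (?C (Suc i) + (\<Sum>k\<le>Suc i. d k))"
      by (simp add: ac_simps)
    \<comment> \<open>Cancelling \<open>?C i\<close> in \<open>ennreal\<close> is legitimate because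
      it is finite.\<close>
    finally show ?case
      using C_fin[of i] unfolding ennreal_add_left_cancel_le by fastforce
  qed (use u(2)[of 0] in \<open>simp add: v0\<close>)
  have d_sum: "(\<Sum>k\<le>i. d k) \<le> ennreal e" for i
  proof -
    have "(\<Sum>k\<le>i. e * (1/2) ^ Suc k) = e * (1 - (1/2) ^ Suc i)"
      by (induction i) (auto simp: field_simps)
    also have "\<dots> \<le> e" using e by (simp add: algebra_simps)
    finally show ?thesis using e by (simp add: d_def sum_ennreal ennreal_leI)
  qed
  show "mixed_capacity \<Omega> p (\<Union>i. E i) \<le> (SUP i. ?C i) + ennreal e"
  proof (rule capacity_functional_increasing_limit[OF v])
    show "capacity_functional (v i) \<le> (SUP i. ?C i) + ennreal e" for i
      using v_le add_mono[OF C_le d_sum] by (rule order_trans)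
    show "(SUP i. ?C i) + ennreal e < \<infinity>" using fin by simp
  qed (simp add: vSuc)
qed

end

theorem theorem5p3:
  fixes \<Omega> :: "(real^'n) set" and p :: "real^'n \<Rightarrow> real" and E :: "nat \<Rightarrow> (real^'n) set"
  assumes "open \<Omega>"
    and "p \<in> borel_measurable (lebesgue_on \<Omega>)"
    and "\<And>x. x \<in> \<Omega> \<Longrightarrow> 1 \<le> p x"
    and "esssup (lebesgue_on \<Omega>) (\<lambda>x. ereal (p x)) < \<infinity>"
    and "\<And>i. E i \<subseteq> E (Suc i)"
    and "\<And>i. E i \<subseteq> \<Omega>"
  shows "(\<lambda>i. mixed_capacity \<Omega> p (E i)) \<longlonglongrightarrow> mixed_capacity \<Omega> p (\<Union>i. E i)"
proof -
  \<comment> \<open>Only an upper bound is taken: for empty \<open>\<Omega>\<close> the essential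
    supremum is minus infinity and not a real number.\<close>
  obtain P where P: "esssup (lebesgue_on \<Omega>) (\<lambda>x. ereal (p x)) \<le> ereal P"
    using assms(4) by (cases "esssup (lebesgue_on \<Omega>) (\<lambda>x. ereal (p x))") auto
  have "AE x in lebesgue_on \<Omega>. p x \<le> P"
    using esssup_AE[of "\<lambda>x. ereal (p x)" "lebesgue_on \<Omega>"]
  proof eventually_elim
    case (elim x)
    then show ?case using order_trans[OF elim P] by simp
  qed
  then interpret bounded_exponent \<Omega> p P
    by unfold_locales (use assms in auto)
  let ?C = "\<lambda>i. mixed_capacity \<Omega> p (E i)"
  have "incseq ?C"
    using assms(5) by (intro incseq_SucI mixed_capacity_mono)
  then have "?C \<longlonglongrightarrow> (SUP i. ?C i)" by (rule LIMSEQ_SUP)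
  moreover have "(SUP i. ?C i) = mixed_capacity \<Omega> p (\<Union>i. E i)"
  proof (rule antisym)
    show "(SUP i. ?C i) \<le> mixed_capacity \<Omega> p (\<Union>i. E i)"
      by (intro SUP_least mixed_capacity_mono) auto
    \<comment> \<open>An infinite supremum makes the bound trivial; otherwise the finite case
      applies.\<close>
    show "mixed_capacity \<Omega> p (\<Union>i. E i) \<le> (SUP i. ?C i)"
      using mixed_capacity_Union_le[of E, OF assms(5)]
      by (cases "(SUP i. ?C i) = \<infinity>") (simp_all only: top_greatest infinity_ennreal_def less_top not_less)
  qed
  ultimately show ?thesis by simp
qed

end
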